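(* Let $S$ be a Cu-semigroup satisfying (O5) and weak cancellation, and let $\mathrm{Lsc}([0,1],\overline{\mathbb{N}})$ be the Cu-semigroup of lower-semicontinuous functions $[0,1]\to\overline{\mathbb{N}}$. Then, given an element $s\in S$ and a compact element $p\in S$ such that $s\leq p$, there exists a Cu-morphism $\mathrm{Lsc}([0,1],\overline{\mathbb{N}})\to S$ mapping $\chi_{(0,1]}$ to $s$ and the constant function $1$ to $p$.
   Context: A positively ordered monoid is a commutative monoid $S$ with a partial order compatible with addition such that $0\le x$ for all $x\in S$. For $x,y\in S$ write $x\ll y$ if for every increasing sequence $(z_n)_n$ in $S$ whose supremum exists and satisfies $y\le \sup_n z_n$, there is $n$ with $x\le z_n$. An element $x$ is compact if $x\ll x$. A Cu-semigroup is a positively ordered monoid $S$ such that: (O1) every increasing sequence in $S$ has a supremum; (O2) every element is the supremum of a $\ll$-increasing sequence; (O3) $x'\ll x$ and $y'\ll y$ imply $x'+y'\ll x+y$; (O4) $\sup_n x_n+\sup_n y_n=\sup_n(x_n+y_n)$ for all increasing sequences $(x_n)_n,(y_n)_n$. A Cu-morphism is a map between Cu-semigroups preserving $0$, addition, order, the relation $\ll$, and suprema of increasing sequences. (O5): whenever $x+y\le z$, $x'\ll x$ and $y'\ll y$, there exists $c$ with $x'+c\le z\le x+c$ and $y'\ll c$. Weak cancellation: $x+z\ll y+z$ implies $x\ll y$. $\overline{\mathbb{N}}=\{0,1,2,\dots\}\cup\{\infty\}$, and $\mathrm{Lsc}([0,1],\overline{\mathbb{N}})$ carries pointwise order and addition;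 $\chi_U$ denotes the indicator function of $U$. *)

theory Defs
  imports "HOL-Analysis.Analysis" "HOL-Library.Lub_Glb"
begin

class positively_ordered_monoid = ordered_comm_monoid_add +
  assumes pos_ordered: "0 \<le> x"

abbreviation is_sup :: "(nat \<Rightarrow> 'a::order) \<Rightarrow> 'a \<Rightarrow> bool" where
  "is_sup z w \<equiv> isLub UNIV (range z) w"

definition way_below :: "'a::order \<Rightarrow> 'a \<Rightarrow> bool"  (infix "\<lless>" 50) where
  "x \<lless> y \<longleftrightarrow> (\<forall>z w. incseq z \<and> is_sup z w \<and> y \<le> w \<longrightarrow> (\<exists>n. x \<le> z n))"

definition compact_element :: "'a::order \<Rightarrow> bool" where
  "compact_element x \<longleftrightarrow> x \<lless> x"

definition cu_O1 :: "'a::order itself \<Rightarrow> bool" where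
  "cu_O1 _ \<longleftrightarrow> (\<forall>z :: nat \<Rightarrow> 'a. incseq z \<longrightarrow> (\<exists>w. is_sup z w))"

definition cu_O2 :: "'a::order itself \<Rightarrow> bool" where
  "cu_O2 _ \<longleftrightarrow> (\<forall>x :: 'a. \<exists>z. (\<forall>n. z n \<lless> z (Suc n)) \<and> is_sup z x)"

definition cu_O3 :: "'a::positively_ordered_monoid itself \<Rightarrow> bool" where
  "cu_O3 _ \<longleftrightarrow> (\<forall>x' x y' y :: 'a. x' \<lless> x \<and> y' \<lless> y \<longrightarrow> x' + y' \<lless> x + y)"

definition cu_O4 :: "'a::positively_ordered_monoid itself \<Rightarrow> bool" where
  "cu_O4 _ \<longleftrightarrow> (\<forall>(x :: nat \<Rightarrow> 'a) y a b. incseq x \<and> incseq y \<and> is_sup x a \<and> is_sup y b \<longrightarrow>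
     is_sup (\<lambda>n. x n + y n) (a + b))"

definition cu_semigroup :: "'a::positively_ordered_monoid itself \<Rightarrow> bool" where
  "cu_semigroup T \<longleftrightarrow> cu_O1 T \<and> cu_O2 T \<and> cu_O3 T \<and> cu_O4 T"

definition cu_O5 :: "'a::positively_ordered_monoid itself \<Rightarrow> bool" where
  "cu_O5 _ \<longleftrightarrow> (\<forall>x' x y' y z :: 'a. x + y \<le> z \<and> x' \<lless> x \<and> y' \<lless> y \<longrightarrow>
     (\<exists>c. x' + c \<le> z \<and> z \<le> x + c \<and> y' \<lless> c))"

definition weak_cancellation :: "'a::positively_ordered_monoid itself \<Rightarrow> bool" where
  "weak_cancellation _ \<longleftrightarrow> (\<forall>x y z :: 'a. x + z \<lless> y + z \<longrightarrow> x \<lless> y)"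

definition cu_morphism ::
    "('a::positively_ordered_monoid \<Rightarrow> 'b::positively_ordered_monoid) \<Rightarrow> bool" where
  "cu_morphism \<phi> \<longleftrightarrow>
     cu_semigroup TYPE('a) \<and> cu_semigroup TYPE('b) \<and>
     \<phi> 0 = 0 \<and>
     (\<forall>x y. \<phi> (x + y) = \<phi> x + \<phi> y) \<and>
     (\<forall>x y. x \<le> y \<longrightarrow> \<phi> x \<le> \<phi> y) \<and>
     (\<forall>x y. x \<lless> y \<longrightarrow> \<phi> x \<lless> \<phi> y) \<and>
     (\<forall>z w. incseq z \<and> is_sup z w \<longrightarrow> is_sup (\<lambda>n. \<phi> (z n)) (\<phi> w))"

definition lower_semicontinuous_on :: "'a::topological_space set \<Rightarrow> ('a \<Rightarrow> 'b::linorder) \<Rightarrow> bool" where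
  "lower_semicontinuous_on X f \<longleftrightarrow> (\<forall>a. openin (top_of_set X) {x \<in> X. a < f x})"

(* A function on [0,1] is encoded as a function on the reals that vanishes off [0,1]; this makes
   equality and the pointwise order on the type agree with those of functions on [0,1]. *)
typedef lsc01 = "{f :: real \<Rightarrow> enat. lower_semicontinuous_on {0..1} f \<and> (\<forall>x. x \<notin> {0..1} \<longrightarrow> f x = 0)}"
  morphisms lsc_fun Abs_lsc01
  by (rule exI[of _ "\<lambda>_. 0"]) (simp add: lower_semicontinuous_on_def)

setup_lifting type_definition_lsc01

lemma lower_semicontinuous_on_indicator:
  assumes "openin (top_of_set X) U"
  shows "lower_semicontinuous_on X (indicator U :: _ \<Rightarrow> enat)"
  unfolding lower_semicontinuous_on_def
proof
  fix a :: enat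
  have "U \<subseteq> X"
    using assms openin_imp_subset by blast
  moreover have "a < 1 \<longleftrightarrow> a = 0"
    by (metis iless_eSuc0 one_eSuc)
  ultimately have "{x \<in> X. a < indicator U x} = (if a = 0 then U else {})"
    by (auto simp: indicator_def split: if_splits)
  then show "openin (top_of_set X) {x \<in> X. a < (indicator U x :: enat)}"
    using assms by simp
qed

lemma less_add_enat_iff:
  fixes b c :: enat
  shows "enat n < b + c \<longleftrightarrow> (\<exists>i j. n < i + j \<and> enat i \<le> b \<and> enat j \<le> c)"
proof
  assume *: "enat n < b + c"
  show "\<exists>i j. n < i + j \<and> enat i \<le> b \<and> enat j \<le> c"
  proof (cases "b = \<infinity> \<or> c = \<infinity>")
    case True
    then show ?thesis
    proof
      assume "b = \<infinity>"
      then show ?thesis by (intro exI[of _ "Suc n"] exI[of _ 0]) (simp flip: zero_enat_def)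
    next
      assume "c = \<infinity>"
      then show ?thesis by (intro exI[of _ 0] exI[of _ "Suc n"]) (simp flip: zero_enat_def)
    qed
  next
    case False
    then obtain i j where "b = enat i" "c = enat j" by auto
    then show ?thesis using * by (intro exI[of _ i] exI[of _ j]) simp
  qed
next
  assume "\<exists>i j. n < i + j \<and> enat i \<le> b \<and> enat j \<le> c"
  then obtain i j where "n < i + j" "enat i \<le> b" "enat j \<le> c" by blast
  then have "enat n < enat i + enat j" "enat i + enat j \<le> b + c"
    by (simp, intro add_mono)
  then show "enat n < b + c" by (rule less_le_trans)
qed

lemma lower_semicontinuous_on_add:
  fixes f g :: "'a::topological_space \<Rightarrow> enat"
  assumes f: "lower_semicontinuous_on X f" and g: "lower_semicontinuous_on X g"
  shows "lower_semicontinuous_on X (\<lambda>x. f x + g x)"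
  unfolding lower_semicontinuous_on_def
proof
  fix a :: enat
  have ge: "openin (top_of_set X) {x \<in> X. enat i \<le> h x}"
    if "lower_semicontinuous_on X h" for h and i :: nat
  proof (cases i)
    case 0
    then show ?thesis by (simp flip: zero_enat_def)
  next
    case (Suc k)
    have "{x \<in> X. enat i \<le> h x} = {x \<in> X. enat k < h x}"
      by (simp add: Suc Suc_ile_eq)
    then show ?thesis using that by (simp add: lower_semicontinuous_on_def)
  qed
  show "openin (top_of_set X) {x \<in> X. a < f x + g x}"
  proof (cases a)
    case (enat n)
    have "{x \<in> X. a < f x + g x} =
        (\<Union>(i, j) \<in> {(i, j). n < i + j}. {x \<in> X. enat i \<le> f x} \<inter> {x \<in> X. enat j \<le> g x})"
      by (auto simp: enat less_add_enat_iff)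
    also have "openin (top_of_set X) \<dots>"
      by (intro openin_Union) (auto intro: openin_Int ge f g)
    finally show ?thesis .
  qed simp
qed

instantiation lsc01 :: positively_ordered_monoid
begin

lift_definition zero_lsc01 :: lsc01 is "\<lambda>_. 0"
  by (simp add: lower_semicontinuous_on_def)

lift_definition plus_lsc01 :: "lsc01 \<Rightarrow> lsc01 \<Rightarrow> lsc01" is "\<lambda>f g x. f x + g x"
  by (simp add: lower_semicontinuous_on_add)

lift_definition less_eq_lsc01 :: "lsc01 \<Rightarrow> lsc01 \<Rightarrow> bool" is "\<lambda>f g. \<forall>x. f x \<le> g x" .

definition less_lsc01 :: "lsc01 \<Rightarrow> lsc01 \<Rightarrow> bool" where
  "less_lsc01 f g \<longleftrightarrow> f \<le> g \<and> \<not> g \<le> f"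

instance
proof
  fix f g h :: lsc01
  show "(f < g) = (f \<le> g \<and> \<not> g \<le> f)" by (rule less_lsc01_def)
  show "f \<le> f" by transfer simp
  show "f \<le> g \<Longrightarrow> g \<le> h \<Longrightarrow> f \<le> h" by transfer (blast intro: order_trans)
  show "f \<le> g \<Longrightarrow> g \<le> f \<Longrightarrow> f = g" by transfer (auto intro: antisym)
  show "f + g + h = f + (g + h)" by transfer (simp add: add.assoc)
  show "f + g = g + f" by transfer (simp add: add.commute)
  show "0 + f = f" by transfer simp
  show "f \<le> g \<Longrightarrow> h + f \<le> h + g" by transfer (simp add: add_left_mono)
  show "0 \<le> f" by transfer simp
qed

end

instantiation lsc01 :: one
begin

lift_definition one_lsc01 :: lsc01 is "\<lambda>x. if x \<in> {0..1} then 1 else 0"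
  using lower_semicontinuous_on_indicator[of "{0..1::real}" "{0..1}"]
  by (simp add: indicator_def lower_semicontinuous_on_def cong: conj_cong)

instance ..

end

(* Meaningful only for U relatively open in [0,1]. *)
definition lsc_indicator :: "real set \<Rightarrow> lsc01" where
  "lsc_indicator U = Abs_lsc01 (indicator U)"

lemma lsc_fun_lsc_indicator:
  assumes "openin (top_of_set {0..1}) U"
  shows "lsc_fun (lsc_indicator U) = indicator U"
  unfolding lsc_indicator_def
proof (rule Abs_lsc01_inverse, intro CollectI conjI allI impI)
  show "lower_semicontinuous_on {0..1} (indicator U :: real \<Rightarrow> enat)"
    using assms by (rule lower_semicontinuous_on_indicator)
  show "indicator U x = (0::enat)" if "x \<notin> {0..1}" for x
    using that openin_imp_subset[OF assms] by (auto simp: indicator_def)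
qed

lemma openin_half_open_unit_interval: "openin (top_of_set {0..1::real}) {0<..1}"
proof -
  have "{0<..1::real} = {0..1} \<inter> {0<..}" by auto
  then show ?thesis by (metis open_greaterThan openin_open_Int)
qed

end

theory Submission
  imports Defs "HOL-Library.Multiset"
begin

text \<open>
  Interpolation and compactness of \<open>p\<close> give a path \<open>a\<close> in \<open>S\<close> with \<open>a u \<lless> a t\<close> for \<open>t < u\<close>, equal to \<open>p\<close> for
  \<open>t < 0\<close>, to \<open>s\<close> at \<open>0\<close> and to \<open>0\<close> for \<open>t \<ge> 1\<close>; \<open>a t\<close> is to be the image of the indicator of \<open>(t, 1]\<close>.
  This determines the image \<open>mass g\<close> of each increasing step function, encoded by the multiset \<open>g\<close> of
  its jumps, and matching jumps shows that \<open>mass\<close> respects \<open>\<lless>\<close>. Every \<open>k \<lless> f\<close> is separated from \<open>f\<close>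
  by a difference of two increasing step functions; (O5) provides an element of \<open>S\<close> representing this
  difference, and weak cancellation shows that it is unique up to \<open>\<lless>\<close>. The image of \<open>f\<close> is the
  element whose way-below set is the set of \<open>c\<close> with \<open>c + mass h \<lless> mass g\<close> for some \<open>g\<close>, \<open>h\<close> such
  that \<open>step g \<lless> step h + f\<close>.
\<close>

section \<open>The way-below relation\<close>

lemma is_sup_iff:
  fixes z :: "nat \<Rightarrow> 'a::order"
  shows "is_sup z w \<longleftrightarrow> (\<forall>n. z n \<le> w) \<and> (\<forall>y. (\<forall>n. z n \<le> y) \<longrightarrow> w \<le> y)"
  by (auto simp: isLub_def isUb_def leastP_def setle_def setge_def)

lemma is_sup_upper: "is_sup z w \<Longrightarrow> z n \<le> w"
  by (simp add: is_sup_iff)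

lemma is_sup_least: "is_sup z w \<Longrightarrow> (\<And>n. z n \<le> y) \<Longrightarrow> w \<le> y"
  by (simp add: is_sup_iff)

lemma is_sup_const: "is_sup (\<lambda>_. w) w"
  unfolding is_sup_iff by simp

lemma way_below_imp_le: "x \<lless> y \<Longrightarrow> x \<le> y"
  unfolding way_below_def using is_sup_const[of y] by (metis monoI order_refl)

lemma way_below_le_trans: "x \<lless> y \<Longrightarrow> y \<le> z \<Longrightarrow> x \<lless> z"
  unfolding way_below_def by (meson order_trans)

lemma le_way_below_trans: "x \<le> y \<Longrightarrow> y \<lless> z \<Longrightarrow> x \<lless> z"
  unfolding way_below_def by (meson order_trans)

lemma way_below_trans: "x \<lless> y \<Longrightarrow> y \<lless> z \<Longrightarrow> x \<lless> z"
  using way_below_imp_le le_way_below_trans by blast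

lemma zero_way_below: "(0::'a::positively_ordered_monoid) \<lless> x"
  by (simp add: way_below_def pos_ordered)

lemma way_belowD: "x \<lless> y \<Longrightarrow> incseq z \<Longrightarrow> is_sup z w \<Longrightarrow> y \<le> w \<Longrightarrow> \<exists>n. x \<le> z n"
  unfolding way_below_def by blast

lemma way_below_chain_sup:
  assumes "\<And>n. z n \<lless> z (Suc n)" and "is_sup z x"
  shows "incseq z" and "z n \<lless> x"
proof -
  show "incseq z"
    using assms(1) by (intro incseq_SucI way_below_imp_le)
  show "z n \<lless> x"
    using way_below_le_trans[OF assms(1)] is_sup_upper[OF assms(2)] .
qed

context
  assumes cu: "cu_semigroup TYPE('a::positively_ordered_monoid)"
begin

lemma cu_chainE:
  obtains z where "\<And>n. z n \<lless> z (Suc n)" "is_sup z (x::'a)" "incseq z" "\<And>n. z n \<lless> x"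
proof -
  obtain z where z: "\<And>n. z n \<lless> z (Suc n)" "is_sup z x"
    using cu unfolding cu_semigroup_def cu_O2_def by blast
  then show thesis
    using that way_below_chain_sup[of z x] by blast
qed

lemma cu_supE:
  assumes "incseq z"
  obtains w where "is_sup z (w::'a)"
  using cu assms unfolding cu_semigroup_def cu_O1_def by blast

lemma cu_add: "x' \<lless> x \<Longrightarrow> y' \<lless> y \<Longrightarrow> x' + y' \<lless> x + (y::'a)"
  using cu unfolding cu_semigroup_def cu_O3_def by blast

lemma cu_sup_add:
  "incseq x \<Longrightarrow> incseq y \<Longrightarrow> is_sup x a \<Longrightarrow> is_sup y b \<Longrightarrow> is_sup (\<lambda>n. x n + y n) (a + (b::'a))"
  using cu unfolding cu_semigroup_def cu_O4_def by blast

lemma cu_leI: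
  assumes "\<And>c. c \<lless> x \<Longrightarrow> c \<le> y"
  shows "x \<le> (y::'a)"
  by (rule cu_chainE[of x]) (use assms is_sup_least in blast)

text \<open>A chain for \<open>y\<close> from (O2) gives \<open>x \<le> z n\<close>, and the next
  term \<open>z (Suc n)\<close> is strictly between in the sense of \<open>\<lless>\<close>.\<close>

lemma cu_interpolate:
  assumes "x \<lless> (y::'a)"
  obtains w where "x \<lless> w" "w \<lless> y"
proof -
  obtain z where z: "\<And>n. z n \<lless> z (Suc n)" "is_sup z y" "incseq z" "\<And>n. z n \<lless> y"
    using cu_chainE[of y] by blast
  obtain n where "x \<le> z n"
    using way_belowD[OF assms z(3,2)] by blast
  then show thesis
    using that[of "z (Suc n)"] z le_way_below_trans by blast
qed

lemma cu_way_below_supD: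
  assumes "x \<lless> y" and "incseq z" and "is_sup z (y::'a)"
  shows "\<exists>n. x \<lless> z n"
proof -
  obtain w where w: "x \<lless> w" "w \<lless> y"
    using cu_interpolate assms(1) .
  then obtain n where "w \<le> z n"
    using way_belowD[OF w(2) assms(2,3)] by blast
  then show ?thesis
    using w way_below_le_trans by blast
qed

end

section \<open>The Cu-semigroup of lower semicontinuous functions\<close>

lemma lsc_fun_simps [simp]:
  "lsc_fun 0 x = 0" "lsc_fun (f + g) x = lsc_fun f x + lsc_fun g x"
  "lsc_fun 1 x = (if x \<in> {0..1} then 1 else 0)"
  by (transfer; simp)+

lemma lsc_le_iff: "f \<le> g \<longleftrightarrow> (\<forall>x. lsc_fun f x \<le> lsc_fun g x)"
  by transfer simp

lemma lsc_eqI: "(\<And>x. lsc_fun f x = lsc_fun g x) \<Longrightarrow> f = g"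
  by (auto simp flip: lsc_fun_inject)

lemma lsc_fun_outside: "x \<notin> {0..1} \<Longrightarrow> lsc_fun f x = 0"
  by transfer simp

lemma lower_semicontinuous_on_enat_iff:
  fixes f :: "'a::topological_space \<Rightarrow> enat"
  shows "lower_semicontinuous_on X f \<longleftrightarrow> (\<forall>m. openin (top_of_set X) {x \<in> X. enat m \<le> f x})"
proof
  assume f: "lower_semicontinuous_on X f"
  show "\<forall>m. openin (top_of_set X) {x \<in> X. enat m \<le> f x}"
  proof
    fix m
    show "openin (top_of_set X) {x \<in> X. enat m \<le> f x}"
      using f by (cases m) (simp_all add: Suc_ile_eq lower_semicontinuous_on_def flip: zero_enat_def)
  qed
next
  assume r: "\<forall>m. openin (top_of_set X) {x \<in> X. enat m \<le> f x}"
  show "lower_semicontinuous_on X f"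
    unfolding lower_semicontinuous_on_def
  proof
    fix a
    show "openin (top_of_set X) {x \<in> X. a < f x}"
      using r[rule_format, of "Suc (the_enat a)"] by (cases a) (simp_all add: Suc_ile_eq)
  qed
qed

lemma lower_semicontinuous_on_enat_iff_dist:
  fixes f :: "'a::metric_space \<Rightarrow> enat"
  shows "lower_semicontinuous_on X f \<longleftrightarrow>
    (\<forall>m. \<forall>x\<in>X. enat m \<le> f x \<longrightarrow> (\<exists>e>0. \<forall>y\<in>X. dist y x < e \<longrightarrow> enat m \<le> f y))"
  unfolding lower_semicontinuous_on_enat_iff openin_euclidean_subtopology_iff by blast

lemma lsc_fun_lower:
  assumes "enat m \<le> lsc_fun f x"
  obtains e where "e > 0" "\<And>y. y \<in> {0..1} \<Longrightarrow> dist y x < e \<Longrightarrow> enat m \<le> lsc_fun f y"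
proof (cases "x \<in> {0..1}")
  case True
  have "lower_semicontinuous_on {0..1} (lsc_fun f)"
    using lsc_fun[of f] by simp
  then show thesis
    using that assms True unfolding lower_semicontinuous_on_enat_iff_dist by blast
next
  case False
  then have "m = 0"
    using assms lsc_fun_outside[OF False, of f] by (simp add: zero_enat_def)
  then show thesis
    using that[of 1] by (simp flip: zero_enat_def)
qed

lemma lsc_fun_surj:
  assumes "lower_semicontinuous_on {0..1} F" and "\<And>x. x \<notin> {0..1} \<Longrightarrow> F x = 0"
  obtains f where "lsc_fun f = F"
  using assms Abs_lsc01_inverse[of F] by blast

lemma enat_le_SUP_iff: "enat m \<le> (SUP n\<in>A. F n) \<longleftrightarrow> m = 0 \<or> (\<exists>n\<in>A. enat m \<le> F n)"
proof (cases m)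
  case 0 then show ?thesis by (simp flip: zero_enat_def)
next
  case (Suc k)
  then show ?thesis by (simp add: Suc_ile_eq less_SUP_iff)
qed

lemma enat_leI:
  assumes "\<And>m. enat m \<le> a \<Longrightarrow> enat m \<le> b"
  shows "a \<le> b"
proof (cases b)
  case (enat k)
  then show ?thesis using assms[of "Suc k"] by (metis Suc_ile_eq linorder_not_less order_less_irrefl)
qed simp

lemma lsc_SUP:
  obtains w where "\<And>x. lsc_fun w x = (SUP n. lsc_fun (z n) x)"
proof -
  let ?F = "\<lambda>x. SUP n. lsc_fun (z n) x"
  have "lower_semicontinuous_on {0..1} ?F"
    unfolding lower_semicontinuous_on_def
  proof
    fix a
    have "{x \<in> {0..1}. a < ?F x} = (\<Union>n. {x \<in> {0..1}. a < lsc_fun (z n) x})"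
      by (auto simp: less_SUP_iff)
    also have "openin (top_of_set {0..1}) \<dots>"
      using lsc_fun by (intro openin_Union) (auto simp: lower_semicontinuous_on_def)
    finally show "openin (top_of_set {0..1}) {x \<in> {0..1}. a < ?F x}" .
  qed
  moreover have "?F x = 0" if "x \<notin> {0..1}" for x
    using lsc_fun_outside[OF that] by simp
  ultimately obtain w where "lsc_fun w = ?F"
    using lsc_fun_surj by blast
  then show thesis using that by (metis (no_types))
qed

text \<open>A pointwise supremum of lower semicontinuous functions is again one, so order suprema
  are computed pointwise, for arbitrary sequences.\<close>

lemma lsc_is_sup_iff: "is_sup z w \<longleftrightarrow> (\<forall>x. lsc_fun w x = (SUP n. lsc_fun (z n) x))"
proof
  assume w: "is_sup z w"
  obtain v where v: "\<And>x. lsc_fun v x = (SUP n. lsc_fun (z n) x)"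
    using lsc_SUP[of z] by blast
  have "is_sup z v"
    unfolding is_sup_iff by (auto simp: lsc_le_iff v intro: SUP_upper SUP_least)
  with w have "v = w"
    by (auto simp: is_sup_iff intro: antisym)
  with v show "\<forall>x. lsc_fun w x = (SUP n. lsc_fun (z n) x)" by simp
next
  assume "\<forall>x. lsc_fun w x = (SUP n. lsc_fun (z n) x)"
  then show "is_sup z w"
    unfolding is_sup_iff by (auto simp: lsc_le_iff intro: SUP_upper SUP_least)
qed

text \<open>The upper semicontinuous envelope of \<open>f\<close> is finite and lies below \<open>g\<close>.\<close>
definition lsc_below :: "lsc01 \<Rightarrow> lsc01 \<Rightarrow> bool" where
  "lsc_below f g \<longleftrightarrow> (\<forall>x\<in>{0..1}. \<exists>m. enat m \<le> lsc_fun g x \<and>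
     (\<exists>e>0. \<forall>y\<in>{0..1}. dist y x < e \<longrightarrow> lsc_fun f y \<le> enat m))"

lemma lsc_below_add:
  assumes "lsc_below f g" and "lsc_below f' g'"
  shows "lsc_below (f + f') (g + g')"
  unfolding lsc_below_def
proof
  fix x :: real assume x: "x \<in> {0..1}"
  obtain m e where m: "enat m \<le> lsc_fun g x" "e > 0"
      "\<And>y. y \<in> {0..1} \<Longrightarrow> dist y x < e \<Longrightarrow> lsc_fun f y \<le> enat m"
    using assms(1) x unfolding lsc_below_def by blast
  obtain m' e' where m': "enat m' \<le> lsc_fun g' x" "e' > 0"
      "\<And>y. y \<in> {0..1} \<Longrightarrow> dist y x < e' \<Longrightarrow> lsc_fun f' y \<le> enat m'"
    using assms(2) x unfolding lsc_below_def by blast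
  show "\<exists>M. enat M \<le> lsc_fun (g + g') x \<and>
      (\<exists>e>0. \<forall>y\<in>{0..1}. dist y x < e \<longrightarrow> lsc_fun (f + f') y \<le> enat M)"
    using m m' by (intro exI[of _ "m + m'"] conjI exI[of _ "min e e'"])
      (auto simp flip: plus_enat_simps(1) intro!: add_mono)
qed

lemma lsc_below_mono: "f' \<le> f \<Longrightarrow> lsc_below f g \<Longrightarrow> g \<le> g' \<Longrightarrow> lsc_below f' g'"
  unfolding lsc_below_def lsc_le_iff by (meson order_trans)

text \<open>Near a point the same integer \<open>m\<close> bounds \<open>f\<close> from above, by
  \<open>lsc_below\<close>, and \<open>g\<close> from below, by lower semicontinuity of
  \<open>g\<close>. Open sets with such a separating integer therefore cover the interval.\<close>

lemma lsc_below_cover: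
  assumes "lsc_below f g"
  obtains C where "\<And>b. b \<in> C \<Longrightarrow> open b" "{0..1} \<subseteq> \<Union>C"
    "\<And>b. b \<in> C \<Longrightarrow> \<exists>m. \<forall>y\<in>b \<inter> {0..1}. lsc_fun f y \<le> enat m \<and> enat m \<le> lsc_fun g y"
proof -
  define C where "C = {b. open b \<and>
    (\<exists>m. \<forall>y\<in>b \<inter> {0..1}. lsc_fun f y \<le> enat m \<and> enat m \<le> lsc_fun g y)}"
  have "x \<in> \<Union>C" if x: "x \<in> {0..1}" for x
  proof -
    obtain m e where m: "enat m \<le> lsc_fun g x" "e > 0"
        "\<And>y. y \<in> {0..1} \<Longrightarrow> dist y x < e \<Longrightarrow> lsc_fun f y \<le> enat m"
      using assms x unfolding lsc_below_def by blast
    obtain e' where e': "e' > 0" "\<And>y. y \<in> {0..1} \<Longrightarrow> dist y x < e' \<Longrightarrow> enat m \<le> lsc_fun g y"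
      using lsc_fun_lower[OF m(1)] by blast
    have "ball x (min e e') \<in> C"
      unfolding C_def using m(3) e'(2) by (auto simp: dist_commute intro!: exI[of _ m])
    then show ?thesis
      using m(2) e'(1) by (intro UnionI[of "ball x (min e e')"]) auto
  qed
  then show thesis
    using that[of C] unfolding C_def by blast
qed

text \<open>Each point has a neighbourhood on which a single \<open>z n\<close> already dominates
  \<open>f\<close>. By compactness finitely many of these suffice, and the largest index works
  everywhere.\<close>

lemma lsc_below_imp_way_below:
  assumes "lsc_below f g"
  shows "f \<lless> g"
  unfolding way_below_def
proof (intro allI impI, elim conjE)
  fix z w assume z: "incseq z" "is_sup z w" "g \<le> w"
  have below: "lsc_below f w"
    using lsc_below_mono[OF order_refl assms z(3)] .
  let ?V = "\<lambda>n b. open b \<and> (\<forall>y\<in>b \<inter> {0..1}. lsc_fun f y \<le> lsc_fun (z n) y)"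
  have "\<exists>b n. x \<in> b \<and> ?V n b" if x: "x \<in> {0..1}" for x
  proof -
    obtain m e where m: "enat m \<le> lsc_fun w x" "e > 0"
        "\<And>y. y \<in> {0..1} \<Longrightarrow> dist y x < e \<Longrightarrow> lsc_fun f y \<le> enat m"
      using below x unfolding lsc_below_def by blast
    obtain n where "enat m \<le> lsc_fun (z n) x"
      using m(1) z(2) by (auto simp: lsc_is_sup_iff enat_le_SUP_iff simp flip: zero_enat_def)
    then obtain e' where e': "e' > 0"
        "\<And>y. y \<in> {0..1} \<Longrightarrow> dist y x < e' \<Longrightarrow> enat m \<le> lsc_fun (z n) y"
      using lsc_fun_lower by blast
    have "lsc_fun f y \<le> lsc_fun (z n) y" if "y \<in> ball x (min e e') \<inter> {0..1}" for y
      using m(3)[of y] e'(2)[of y] that by (auto simp: dist_commute intro: order_trans)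
    then show ?thesis
      using m(2) e'(1) by (intro exI[of _ "ball x (min e e')"] exI[of _ n]) auto
  qed
  then obtain b n where b: "\<And>x. x \<in> {0..1} \<Longrightarrow> x \<in> b x \<and> ?V (n x) (b x)"
    by metis
  have "{0..1} \<subseteq> (\<Union>x\<in>{0..1}. b x)"
    using b by (meson UN_I subsetI)
  moreover have "open (b x)" if "x \<in> {0..1}" for x
    using b[OF that] by simp
  ultimately obtain X where X: "X \<subseteq> {0..1}" "finite X" "{0..1} \<subseteq> (\<Union>x\<in>X. b x)"
    using compactE_image[OF compact_Icc, of "{0..1}" b 0 1] by blast
  define N where "N = Max (insert 0 (n ` X))"
  have "lsc_fun f y \<le> lsc_fun (z N) y" for y
  proof (cases "y \<in> {0..1}")
    case True
    then obtain x where x: "x \<in> X" "y \<in> b x"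
      using X by blast
    then have "n x \<le> N"
      unfolding N_def using X by (intro Max_ge) auto
    then have "lsc_fun (z (n x)) y \<le> lsc_fun (z N) y"
      using z(1) by (meson incseqD lsc_le_iff)
    then show ?thesis
      using b[of x] x X True by (meson IntI order_trans subsetD)
  qed (simp add: lsc_fun_outside)
  then show "\<exists>n. f \<le> z n"
    by (auto simp: lsc_le_iff)
qed

text \<open>The approximants are infima of \<open>f\<close> over closed balls of shrinking radius,
  truncated at \<open>n\<close> so that they are finite. Lower semicontinuity of \<open>f\<close>
  makes them converge to \<open>f\<close>.\<close>

lemma lsc_approx:
  obtains k where "\<And>n. lsc_below (k n) (k (Suc n))" "is_sup k f"
proof -
  let ?r = "\<lambda>n. inverse (real (Suc n))"
  define F where "F n x = (if x \<in> {0..1}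
    then min (enat n) (INF y\<in>cball x (?r n) \<inter> {0..1}. lsc_fun f y) else 0)" for n and x :: real
  have le_F: "enat m \<le> F n x \<longleftrightarrow> m \<le> n \<and> (\<forall>y\<in>cball x (?r n) \<inter> {0..1}. enat m \<le> lsc_fun f y)"
    if "x \<in> {0..1}" for n m x
    using that by (simp add: F_def le_INF_iff)
  have lsc: "lower_semicontinuous_on {0..1} (F n)" for n
    unfolding lower_semicontinuous_on_enat_iff
  proof
    fix m
    let ?C = "{y \<in> {0..1}. \<not> enat m \<le> lsc_fun f y}"
    have "openin (top_of_set {0..1}) ({0..1} - ?C)"
    proof -
      have "lower_semicontinuous_on {0..1} (lsc_fun f)"
        using lsc_fun[of f] by simp
      moreover have "{0..1} - ?C = {y \<in> {0..1}. enat m \<le> lsc_fun f y}" by auto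
      ultimately show ?thesis
        unfolding lower_semicontinuous_on_enat_iff by metis
    qed
    then have "closedin (top_of_set {0..1}) ?C"
      by (auto simp: closedin_def)
    then have C: "compact ?C"
      using closedin_compact by blast
    \<comment> \<open>\<open>D\<close> consists of the points within distance \<open>?r n\<close> of
      \<open>?C\<close>, where \<open>f\<close> is below \<open>m\<close>. As the sum of two compact
      sets it is closed, and off \<open>D\<close> the infimum over the ball is at least
      \<open>m\<close>.\<close>
    define D where "D = (\<Union>x\<in>?C. \<Union>y\<in>cball 0 (?r n). {x + y})"
    have "closed D"
      unfolding D_def using C by (intro compact_closed_sums) auto
    moreover have "{x \<in> {0..1}. \<not> enat m \<le> F n x} =
        (if m \<le> n then {0..1} \<inter> D else {0..1})"
    proof (cases "m \<le> n")
      case True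
      have "(\<exists>y\<in>cball x (?r n) \<inter> {0..1}. \<not> enat m \<le> lsc_fun f y) \<longleftrightarrow>
          x \<in> D" (is "?L \<longleftrightarrow> ?R") for x
      proof
        assume ?L
        then obtain y where y: "y \<in> ?C" "dist x y \<le> ?r n" by auto
        then have "x = y + (x - y)" "x - y \<in> cball 0 (?r n)" by (auto simp: dist_norm)
        with y(1) show ?R unfolding D_def by blast
      next
        assume ?R
        then show ?L by (auto simp: D_def dist_norm)
      qed
      with True show ?thesis
        using le_F[of _ m n] by (simp add: set_eq_iff del: of_nat_Suc) blast
    qed (auto simp: le_F)
    ultimately have "closedin (top_of_set {0..1}) {x \<in> {0..1}. \<not> enat m \<le> F n x}"
      by (auto simp: closedin_closed_Int)
    moreover have "{0..1} - {x \<in> {0..1}. \<not> enat m \<le> F n x} = {x \<in> {0..1}. enat m \<le> F n x}" by auto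
    ultimately show "openin (top_of_set {0..1}) {x \<in> {0..1}. enat m \<le> F n x}"
      unfolding closedin_def by (metis topspace_euclidean_subtopology)
  qed
  have "\<forall>n. \<exists>k. lsc_fun k = F n"
  proof
    fix n
    show "\<exists>k. lsc_fun k = F n"
      by (rule lsc_fun_surj[OF lsc[of n]]) (auto simp: F_def)
  qed
  then obtain k where k: "\<And>n. lsc_fun (k n) = F n" by metis
  have "lsc_below (k n) (k (Suc n))" for n
    unfolding lsc_below_def k
  proof
    fix x :: real assume x: "x \<in> {0..1}"
    have fin: "F i y \<le> enat i" for i y
      by (simp add: F_def)
    obtain m where m: "F (Suc n) x = enat m"
      using fin[of "Suc n" x] by (cases "F (Suc n) x") auto
    have pos: "?r n - ?r (Suc n) > 0"
      by (simp add: divide_simps)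
    \<comment> \<open>The ball of radius \<open>?r (Suc n)\<close> about \<open>x\<close> lies in
      the ball of radius \<open>?r n\<close> about \<open>y\<close>, so the infimum for
      \<open>y\<close> is the smaller one.\<close>
    have "F n y \<le> F (Suc n) x" if y: "y \<in> {0..1}" "dist y x < ?r n - ?r (Suc n)" for y
    proof (rule enat_leI)
      fix j assume j: "enat j \<le> F n y"
      have "enat j \<le> lsc_fun f v" if "v \<in> cball x (?r (Suc n)) \<inter> {0..1}" for v
      proof -
        have "dist y v \<le> ?r n"
          using dist_triangle[of y v x] y that by (auto simp del: of_nat_Suc)
        then show ?thesis
          using j that by (auto simp: le_F[OF y(1)] simp del: of_nat_Suc)
      qed
      then show "enat j \<le> F (Suc n) x"
        using j by (auto simp: le_F[OF x] le_F[OF y(1)] simp del: of_nat_Suc)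
    qed
    then show "\<exists>m. enat m \<le> F (Suc n) x \<and> (\<exists>e>0. \<forall>y\<in>{0..1}. dist y x < e \<longrightarrow> F n y \<le> enat m)"
      using pos m by (intro exI[of _ m] conjI exI[of _ "?r n - ?r (Suc n)"]) auto
  qed
  moreover have "is_sup k f"
    unfolding lsc_is_sup_iff k
  proof
    fix x
    show "lsc_fun f x = (SUP n. F n x)"
    proof (cases "x \<in> {0..1}")
      case True
      show ?thesis
      proof (rule antisym)
        show "(SUP n. F n x) \<le> lsc_fun f x"
          using True by (intro SUP_least) (auto simp: F_def intro!: min.coboundedI2 INF_lower)
        show "lsc_fun f x \<le> (SUP n. F n x)"
        proof (rule enat_leI)
          fix m assume "enat m \<le> lsc_fun f x"
          then obtain e where e: "e > 0" "\<And>y. y \<in> {0..1} \<Longrightarrow> dist y x < e \<Longrightarrow> enat m \<le> lsc_fun f y"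
            using lsc_fun_lower by blast
          obtain n0 where n0: "?r n0 < e"
            using reals_Archimedean[OF e(1)] by blast
          \<comment> \<open>Index at least \<open>m\<close> keeps the truncation from cutting below
            \<open>m\<close>; index at least \<open>n0\<close> makes the ball smaller than
            \<open>e\<close>.\<close>
          let ?n = "max m n0"
          have "?r ?n \<le> ?r n0" by (simp add: divide_simps)
          with n0 have "?r ?n < e" by (rule le_less_trans[rotated])
          then have "enat m \<le> F ?n x"
            unfolding le_F[OF True] using e(2) by (auto simp: dist_commute intro: le_less_trans)
          then show "enat m \<le> (SUP n. F n x)"
            unfolding enat_le_SUP_iff by blast
        qed
      qed
    qed (auto simp: F_def lsc_fun_outside)
  qed
  ultimately show thesis using that by blast
qed

text \<open>If \<open>f \<lless> g\<close>, then \<open>f\<close> lies under some term of the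
  approximating chain of \<open>g\<close>, and that term is \<open>lsc_below\<close> the next
  one.\<close>

lemma lsc_way_below_iff: "f \<lless> g \<longleftrightarrow> lsc_below f g"
proof
  assume fg: "f \<lless> g"
  obtain k where k: "\<And>n. lsc_below (k n) (k (Suc n))" "is_sup k g"
    using lsc_approx[of g] by blast
  have "incseq k"
    using k(1) lsc_below_imp_way_below way_below_imp_le by (intro incseq_SucI) blast
  then obtain n where "f \<le> k n"
    using way_belowD[OF fg _ k(2)] by blast
  then show "lsc_below f g"
    using lsc_below_mono k(1)[of n] is_sup_upper[OF k(2)] by blast
qed (rule lsc_below_imp_way_below)

lemma enat_SUP_add:
  fixes x y :: "nat \<Rightarrow> enat"
  assumes "incseq x" and "incseq y"
  shows "(SUP n. x n + y n) = (SUP n. x n) + (SUP n. y n)"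
proof (rule antisym)
  show "(SUP n. x n + y n) \<le> (SUP n. x n) + (SUP n. y n)"
    by (intro SUP_least add_mono SUP_upper) auto
  show "(SUP n. x n) + (SUP n. y n) \<le> (SUP n. x n + y n)"
  proof (rule enat_leI)
    fix m assume m: "enat m \<le> (SUP n. x n) + (SUP n. y n)"
    show "enat m \<le> (SUP n. x n + y n)"
    proof (cases m)
      case (Suc k)
      then obtain i j where ij: "k < i + j" "enat i \<le> (SUP n. x n)" "enat j \<le> (SUP n. y n)"
        using m by (auto simp: Suc_ile_eq less_add_enat_iff)
      obtain n n' where n: "enat i \<le> x n" "enat j \<le> y n'"
        using ij by (auto simp: enat_le_SUP_iff simp flip: zero_enat_def)
      have "enat i \<le> x (max n n')" "enat j \<le> y (max n n')"
        using n assms by (meson incseqD max.cobounded1 max.cobounded2 order_trans)+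
      then have "enat i + enat j \<le> x (max n n') + y (max n n')"
        by (rule add_mono)
      moreover have "enat m \<le> enat i + enat j"
        using ij Suc by simp
      ultimately show ?thesis
        by (meson SUP_upper UNIV_I order_trans)
    qed (simp flip: zero_enat_def)
  qed
qed

lemma cu_semigroup_lsc01: "cu_semigroup TYPE(lsc01)"
  unfolding cu_semigroup_def
proof (intro conjI)
  show "cu_O1 TYPE(lsc01)"
    unfolding cu_O1_def by (metis lsc_is_sup_iff lsc_SUP)
  show "cu_O2 TYPE(lsc01)"
    unfolding cu_O2_def by (metis lsc_below_imp_way_below lsc_approx)
  show "cu_O3 TYPE(lsc01)"
    unfolding cu_O3_def by (simp add: lsc_way_below_iff lsc_below_add)
  show "cu_O4 TYPE(lsc01)"
    unfolding cu_O4_def lsc_is_sup_iff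
    by (auto intro!: enat_SUP_add[symmetric] simp: incseq_def lsc_le_iff)
qed

text \<open>
  The point is that \<open>k\<close> is lower semicontinuous: near a point it does not drop below its
  value there, so it can be cancelled between the two hypotheses.
\<close>
lemma lsc_way_below_cancel_middle:
  assumes "g \<lless> h' + k" and "k + h \<lless> g'"
  shows "g + h \<lless> h' + (g' :: lsc01)"
  unfolding lsc_way_below_iff lsc_below_def
proof
  fix x :: real assume x: "x \<in> {0..1}"
  obtain m e where m: "enat m \<le> lsc_fun h' x + lsc_fun k x" "e > 0"
      "\<And>y. y \<in> {0..1} \<Longrightarrow> dist y x < e \<Longrightarrow> lsc_fun g y \<le> enat m"
    using assms(1) x unfolding lsc_way_below_iff lsc_below_def lsc_fun_simps by blast
  obtain m' e' where m': "enat m' \<le> lsc_fun g' x" "e' > 0"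
      "\<And>y. y \<in> {0..1} \<Longrightarrow> dist y x < e' \<Longrightarrow> lsc_fun k y + lsc_fun h y \<le> enat m'"
    using assms(2) x unfolding lsc_way_below_iff lsc_below_def lsc_fun_simps by blast
  have "lsc_fun k x + lsc_fun h x \<le> enat m'"
    using m'(2) m'(3)[OF x] by simp
  then obtain q where q: "lsc_fun k x = enat q"
    by (cases "lsc_fun k x") auto
  obtain e'' where e'': "e'' > 0" "\<And>y. y \<in> {0..1} \<Longrightarrow> dist y x < e'' \<Longrightarrow> enat q \<le> lsc_fun k y"
    using lsc_fun_lower[of q k x] q by auto
  have qm: "q \<le> m'"
    using \<open>lsc_fun k x + lsc_fun h x \<le> enat m'\<close> q by (cases "lsc_fun h x") auto
  \<comment> \<open>Since \<open>k\<close> stays at least \<open>q\<close>, its value at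
    \<open>x\<close>, the bound \<open>m'\<close> for \<open>k + h\<close> leaves at most
    \<open>m' - q\<close> for \<open>h\<close>. The fact \<open>qm\<close> makes this a genuine
    subtraction.\<close>
  have "lsc_fun (g + h) y \<le> enat (m + (m' - q))"
    if y: "y \<in> {0..1}" "dist y x < min e (min e' e'')" for y
  proof -
    have "enat q + lsc_fun h y \<le> lsc_fun k y + lsc_fun h y"
      using e''(2)[OF y(1)] y(2) by (intro add_right_mono) simp
    also have "\<dots> \<le> enat m'"
      using m'(3) y by simp
    finally have "lsc_fun h y \<le> enat (m' - q)"
      by (cases "lsc_fun h y") auto
    moreover have "lsc_fun g y \<le> enat m"
      using m(3) y by simp
    ultimately show ?thesis
      using add_mono[of "lsc_fun g y" "enat m" "lsc_fun h y" "enat (m' - q)"] by simp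
  qed
  moreover have "enat (m + (m' - q)) \<le> lsc_fun (h' + g') x"
  proof -
    have "enat m + enat (m' - q) \<le> (lsc_fun h' x + enat q) + enat (m' - q)"
      using m(1) q by (intro add_right_mono) simp
    also have "\<dots> = lsc_fun h' x + enat m'"
      using qm by (simp add: add.assoc)
    also have "\<dots> \<le> lsc_fun h' x + lsc_fun g' x"
      using m'(1) by (rule add_left_mono)
    finally show ?thesis by simp
  qed
  ultimately show "\<exists>M. enat M \<le> lsc_fun (h' + g') x \<and>
      (\<exists>e>0. \<forall>y\<in>{0..1}. dist y x < e \<longrightarrow> lsc_fun (g + h) y \<le> enat M)"
    using m(2) m'(2) e''(1)
    by (intro exI[of _ "m + (m' - q)"] conjI exI[of _ "min e (min e' e'')"]) auto
qed

section \<open>Increasing step functions\<close>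

text \<open>Negative jumps contribute the constant 1 and jumps at or beyond 1 contribute 0, so
  constants need no separate encoding.\<close>

definition step :: "real multiset \<Rightarrow> lsc01" where
  "step g = (\<Sum>t\<in>#g. lsc_indicator {x\<in>{0..1}. t < x})"

lemma step_simps [simp]:
  "step {#} = 0" "step (g + h) = step g + step h"
  by (simp_all add: step_def)

lemma lsc_fun_step:
  assumes "x \<in> {0..1}"
  shows "lsc_fun (step g) x = enat (size {#t \<in># g. t < x#})"
proof (induction g)
  case (add t g)
  have "{x\<in>{0..1}. t < x} = {0..1} \<inter> {t<..}" by auto
  then have "openin (top_of_set {0..1}) {x\<in>{0..1}. t < x}"
    by (metis open_greaterThan openin_open_Int)
  then have "lsc_fun (lsc_indicator {x\<in>{0..1}. t < x}) x = (if t < x then 1 else 0)"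
    using assms by (simp add: lsc_fun_lsc_indicator indicator_def)
  with add show ?case
    by (simp add: step_def one_enat_def flip: zero_enat_def)
qed (simp flip: zero_enat_def)

lemma step_neg: "t < 0 \<Longrightarrow> step {#t#} = 1"
  by (rule lsc_eqI) (use lsc_fun_step[of _ "{#t#}"] lsc_fun_outside in
    \<open>force simp: one_enat_def\<close>)

lemma step_zero: "step {#0#} = lsc_indicator {0<..1}"
proof -
  have "{x\<in>{0..1}. 0 < x} = {0<..1::real}" by auto
  then show ?thesis by (simp add: step_def)
qed

text \<open>\<open>step g\<close> just to the right of \<open>z\<close> counts the jumps
  \<open>t \<le> z\<close>, while \<open>step h\<close> at \<open>z\<close> counts only jumps
  \<open>u < z\<close>; compact containment compares these two values. The condition
  \<open>z < 1\<close> leaves room to the right.\<close>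

lemma step_way_below_count:
  assumes "step g \<lless> step h" and z: "z \<in> {0..<1}"
  shows "size {#t \<in># g. t \<le> z#} \<le> size {#u \<in># h. u < z#}"
proof -
  have z': "z \<in> {0..1}" using z by simp
  obtain m e where m: "enat m \<le> lsc_fun (step h) z" "e > 0"
      "\<And>y. y \<in> {0..1} \<Longrightarrow> dist y z < e \<Longrightarrow> lsc_fun (step g) y \<le> enat m"
    using assms(1) z' unfolding lsc_way_below_iff lsc_below_def by blast
  define y where "y = min 1 (z + e / 2)"
  have y: "y \<in> {0..1}" "dist y z < e" "z < y"
    using z m(2) by (auto simp: y_def dist_norm)
  have "size {#t \<in># g. t \<le> z#} \<le> size {#t \<in># g. t < y#}"
    using y(3) by (intro size_mset_mono filter_mset_mono_strong) auto
  also have "\<dots> \<le> m"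
    using m(3)[OF y(1,2)] by (simp add: lsc_fun_step[OF y(1)])
  also have "\<dots> \<le> size {#u \<in># h. u < z#}"
    using m(1) by (simp add: lsc_fun_step[OF z'])
  finally show ?thesis .
qed

section \<open>Jump counts and grid approximation\<close>

definition jumps :: "(nat \<Rightarrow> real) \<Rightarrow> (nat \<Rightarrow> nat) \<Rightarrow> nat \<Rightarrow> real multiset" where
  "jumps \<tau> w N = (\<Sum>j<N. replicate_mset (w j) (\<tau> j))"

lemma size_filter_jumps:
  "size {#t \<in># jumps \<tau> w N. P t#} = (\<Sum>j<N. if P (\<tau> j) then w j else 0)"
proof (induction N)
  case (Suc N)
  have "size {#t \<in># replicate_mset n x. P t#} = (if P x then n else 0)" for n x
    by (induction n) auto
  with Suc show ?case by (simp add: jumps_def)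
qed (simp add: jumps_def)

lemma size_jumps_upper:
  assumes "\<And>j. i < j \<Longrightarrow> y \<le> \<tau> j"
  shows "size {#t \<in># jumps \<tau> w N. t < y#} \<le> (\<Sum>j<Suc i. w j)"
proof -
  have "(\<Sum>j<N. if \<tau> j < y then w j else 0) \<le> (\<Sum>j<N. if j < Suc i then w j else 0)"
    using assms by (intro sum_mono) (force dest: assms leD simp: less_Suc_eq_le not_le)
  also have "\<dots> = (\<Sum>j\<in>{..<N} \<inter> {..<Suc i}. w j)"
    by (subst sum.inter_restrict) auto
  also have "\<dots> \<le> (\<Sum>j<Suc i. w j)"
    by (intro sum_mono2) auto
  finally show ?thesis by (simp add: size_filter_jumps)
qed

lemma size_jumps_lower:
  assumes "\<And>j. j < i \<Longrightarrow> \<tau> j < y" and "i \<le> N"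
  shows "(\<Sum>j<i. w j) \<le> size {#t \<in># jumps \<tau> w N. t < y#}"
proof -
  have "(\<Sum>j<i. w j) = (\<Sum>j<i. if \<tau> j < y then w j else 0)"
    using assms(1) by (intro sum.cong) auto
  also have "\<dots> \<le> (\<Sum>j<N. if \<tau> j < y then w j else 0)"
    using assms(2) by (intro sum_mono2) auto
  finally show ?thesis by (simp add: size_filter_jumps)
qed

text \<open>A Lebesgue number for the cover of \<open>lsc_below_cover\<close> provides the mesh. The
  windows have radius twice the mesh, so that each cell lies inside the windows of both of its
  endpoints.\<close>

lemma lsc_way_below_grid:
  assumes "k \<lless> (f :: lsc01)"
  obtains N :: nat and m :: "nat \<Rightarrow> nat" where "N > 0"
    "\<And>i y. i \<le> N \<Longrightarrow> y \<in> {0..1} \<Longrightarrow> dist y (real i / real N) < 2 / real N \<Longrightarrow>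
      lsc_fun k y \<le> enat (m i) \<and> enat (m i) \<le> lsc_fun f y"
proof -
  obtain C where C: "\<And>b. b \<in> C \<Longrightarrow> open b" "{0..1} \<subseteq> \<Union>C"
    "\<And>b. b \<in> C \<Longrightarrow> \<exists>m. \<forall>y\<in>b \<inter> {0..1}. lsc_fun k y \<le> enat m \<and> enat m \<le> lsc_fun f y"
    using assms unfolding lsc_way_below_iff by (elim lsc_below_cover) blast
  obtain e where e: "e > 0" "\<forall>x\<in>{0..1}. \<exists>b\<in>C. ball x e \<subseteq> b"
    using Heine_Borel_lemma[OF compact_Icc C(2)] C(1) by metis
  obtain n where n: "inverse (real (Suc n)) < e / 2"
    using reals_Archimedean[of "e / 2"] e(1) by auto
  define N where "N = Suc n"
  have N: "2 / real N < e"
    using n by (simp add: N_def field_simps)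
  have "\<exists>m. \<forall>y\<in>{0..1}. dist y (real i / real N) < 2 / real N \<longrightarrow>
      lsc_fun k y \<le> enat m \<and> enat m \<le> lsc_fun f y" if "i \<le> N" for i
  proof -
    have "real i / real N \<in> {0..1}"
      using that by (simp add: N_def divide_simps)
    then obtain b where b: "b \<in> C" "ball (real i / real N) e \<subseteq> b"
      using e(2) by blast
    obtain m where m: "\<forall>y\<in>b \<inter> {0..1}. lsc_fun k y \<le> enat m \<and> enat m \<le> lsc_fun f y"
      using C(3)[OF b(1)] by blast
    have "y \<in> b" if "dist y (real i / real N) < 2 / real N" for y
      using b(2) N that by (auto simp: dist_commute)
    with m show ?thesis by blast
  qed
  then obtain m where "\<And>i y. i \<le> N \<Longrightarrow> y \<in> {0..1} \<Longrightarrow> dist y (real i / real N) < 2 / real N \<Longrightarrow>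
      lsc_fun k y \<le> enat (m i) \<and> enat (m i) \<le> lsc_fun f y"
    by metis
  then show thesis
    using that[of N m] by (simp add: N_def)
qed

lemma unit_interval_cell:
  assumes "x \<in> {0..1::real}" and "N > 0"
  obtains i where "i < N" "real i / real N \<le> x" "x \<le> real (Suc i) / real N"
proof -
  have Nx: "0 \<le> real N * x" "real N * x \<le> real N"
    using assms by (auto intro: mult_left_le)
  \<comment> \<open>The cap \<open>N - 1\<close> handles \<open>x = 1\<close>, where the floor is
    \<open>N\<close>.\<close>
  define i where "i = min (nat \<lfloor>real N * x\<rfloor>) (N - 1)"
  have "i < N" using assms(2) by (simp add: i_def)
  moreover have "real i \<le> real N * x"
    using Nx by (simp add: i_def min_def split: if_splits) linarith
  moreover have "real N * x \<le> real (Suc i)"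
    using Nx assms(2) unfolding i_def min_def by (auto simp: of_nat_diff) linarith
  ultimately show thesis
    using assms(2) that[of i] by (auto simp: field_simps)
qed

text \<open>Natural subtraction truncates, so the two sums collect the descents and the ascents of
  \<open>m\<close> separately: this is a discrete Jordan decomposition.\<close>

lemma sum_jumps_balance:
  fixes m :: "nat \<Rightarrow> nat"
  shows "m i + (\<Sum>j<i. m j - m (Suc j)) = m 0 + (\<Sum>j<i. m (Suc j) - m j)"
proof (induction i)
  case (Suc i)
  then show ?case by simp
qed simp

section \<open>Interpolated chains\<close>

text \<open>Dyadic subdivision: index \<open>j\<close> at level \<open>n\<close> stands for the
  parameter \<open>j / 2 ^ n\<close>. Old points move to even indices and interpolants fill the odd
  ones.\<close>

primrec refine :: "('b \<Rightarrow> 'b \<Rightarrow> 'b) \<Rightarrow> (nat \<Rightarrow> 'b) \<Rightarrow> nat \<Rightarrow> nat \<Rightarrow> 'b" where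
  "refine mid s 0 = s"
| "refine mid s (Suc n) = (\<lambda>j. if even j then refine mid s n (j div 2)
     else mid (refine mid s n (j div 2)) (refine mid s n (Suc (j div 2))))"

lemma refine_scale: "refine mid s (n + k) (2 ^ k * j) = refine mid s n j"
proof (induction k)
  case (Suc k)
  have "even (2 ^ Suc k * j)" "(2 ^ Suc k * j) div 2 = 2 ^ k * j"
    by (simp_all add: mult.assoc)
  then show ?case
    using Suc by (simp only: add_Suc_right refine.simps if_True)
qed simp

context
  fixes mid :: "'a::order \<Rightarrow> 'a \<Rightarrow> 'a" and s :: "nat \<Rightarrow> 'a"
  assumes mid: "\<And>x y. x \<lless> y \<Longrightarrow> x \<lless> mid x y \<and> mid x y \<lless> y"
    and s: "\<And>n. s n \<lless> s (Suc n)"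
begin

lemma refine_Suc: "refine mid s n j \<lless> refine mid s n (Suc j)"
proof (induction n arbitrary: j)
  case (Suc n)
  then show ?case using mid by simp
qed (simp add: s)

lemma refine_less: "j < j' \<Longrightarrow> refine mid s n j \<lless> refine mid s n j'"
  by (induction rule: less_Suc_induct) (auto intro: refine_Suc way_below_trans)

lemma refine_mono: "j \<le> j' \<Longrightarrow> refine mid s n j \<le> refine mid s n j'"
  using refine_less[of j j' n] way_below_imp_le by (cases "j = j'") auto

lemma refine_level: "refine mid s n (j div 2) \<le> refine mid s (Suc n) j"
  using mid[OF refine_Suc, of n "j div 2"] by (auto intro: way_below_imp_le)

lemma refine_incseq: "incseq (\<lambda>n. refine mid s n (nat \<lfloor>2 ^ n * (r::real)\<rfloor>))"
proof (rule incseq_SucI)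
  fix n
  have "\<lfloor>2 * (2 ^ n * r)\<rfloor> div 2 = \<lfloor>2 ^ n * r\<rfloor>"
    using floor_divide_real_eq_div[of 2 "2 * (2 ^ n * r)"] by simp
  then have "nat \<lfloor>2 ^ Suc n * r\<rfloor> div 2 = nat \<lfloor>2 ^ n * r\<rfloor>"
    by (metis mult.assoc nat_div_distrib' nat_numeral power_Suc zero_le_numeral)
  then show "refine mid s n (nat \<lfloor>2 ^ n * r\<rfloor>) \<le> refine mid s (Suc n) (nat \<lfloor>2 ^ Suc n * r\<rfloor>)"
    using refine_level by metis
qed

text \<open>Rescaled to the common level \<open>n + m\<close>, the right end of the level
  \<open>n\<close> dyadic cell of \<open>r\<close> lies beyond the left end of the cell of
  \<open>r\<close> there, which dominates the one at level \<open>m\<close>.\<close>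

lemma refine_upper:
  assumes "(r::real) \<ge> 0"
  shows "refine mid s m (nat \<lfloor>2 ^ m * r\<rfloor>) \<le> refine mid s n (Suc (nat \<lfloor>2 ^ n * r\<rfloor>))"
proof -
  have "refine mid s m (nat \<lfloor>2 ^ m * r\<rfloor>) \<le> refine mid s (n + m) (nat \<lfloor>2 ^ (n + m) * r\<rfloor>)"
    using incseqD[OF refine_incseq, of m "n + m"] by simp
  also have "\<dots> \<le> refine mid s (n + m) (2 ^ m * Suc (nat \<lfloor>2 ^ n * r\<rfloor>))"
  proof (rule refine_mono)
    have "2 ^ n * r < real (Suc (nat \<lfloor>2 ^ n * r\<rfloor>))"
      using assms by (simp add: floor_less_iff) linarith
    then have "2 ^ m * (2 ^ n * r) \<le> 2 ^ m * real (Suc (nat \<lfloor>2 ^ n * r\<rfloor>))"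
      by (intro mult_left_mono) auto
    then have "2 ^ (n + m) * r \<le> real (2 ^ m * Suc (nat \<lfloor>2 ^ n * r\<rfloor>))"
      unfolding of_nat_mult of_nat_power of_nat_numeral power_add by (simp only: mult_ac)
    then show "nat \<lfloor>2 ^ (n + m) * r\<rfloor> \<le> 2 ^ m * Suc (nat \<lfloor>2 ^ n * r\<rfloor>)"
      by linarith
  qed
  also have "\<dots> = refine mid s n (Suc (nat \<lfloor>2 ^ n * r\<rfloor>))"
    by (rule refine_scale)
  finally show ?thesis .
qed

end

text \<open>\<open>A r\<close> is the supremum of the chain at the left ends of the dyadic cells
  containing \<open>r\<close>. The right ends bound it from above, so strict comparison reduces to
  finding a level fine enough to separate \<open>r\<close> from \<open>t\<close>.\<close>

lemma cu_dense_chain: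
  fixes s :: "nat \<Rightarrow> 'a::positively_ordered_monoid"
  assumes cu: "cu_semigroup TYPE('a)" and s: "\<And>n. s n \<lless> s (Suc n)"
  obtains A :: "real \<Rightarrow> 'a" where "\<And>r t. 0 \<le> r \<Longrightarrow> r < t \<Longrightarrow> A r \<lless> A t"
    "\<And>n. s n \<le> A (real n)" "\<And>r. 0 \<le> r \<Longrightarrow> \<exists>n. A r \<le> s n"
proof -
  obtain mid where mid: "\<And>x y::'a. x \<lless> y \<Longrightarrow> x \<lless> mid x y \<and> mid x y \<lless> y"
  proof -
    have "\<exists>w. x \<lless> w \<and> w \<lless> y" if "x \<lless> y" for x y :: 'a
      using cu_interpolate[OF cu that] by blast
    then show thesis
      using that by metis
  qed
  let ?b = "refine mid s" and ?i = "\<lambda>n r. nat \<lfloor>2 ^ n * r\<rfloor>"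
  have "\<exists>w. is_sup (\<lambda>n. ?b n (?i n r)) w" if "0 \<le> r" for r :: real
    using cu_supE[OF cu refine_incseq[of mid s, OF mid s]] by blast
  then obtain A where A: "\<And>r::real. 0 \<le> r \<Longrightarrow> is_sup (\<lambda>n. ?b n (?i n r)) (A r)"
    by metis
  have upper: "A r \<le> ?b n (Suc (?i n r))" if "0 \<le> r" for r n
    using is_sup_least[OF A[OF that]] refine_upper[of mid s, OF mid s that] by blast
  have lower: "?b n (?i n r) \<le> A r" if "0 \<le> r" for r n
    using is_sup_upper[OF A[OF that]] .
  have "A r \<lless> A t" if rt: "0 \<le> r" "r < t" for r t
  proof -
    \<comment> \<open>At this level the parameters differ by more than two cells, so the right end
      for \<open>r\<close> has smaller index than the left end for \<open>t\<close>.\<close>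
    obtain n where n: "2 / (t - r) < 2 ^ n"
      using real_arch_pow[of 2 "2 / (t - r)"] by auto
    have "2 < 2 ^ n * (t - r)"
      using n rt by (simp add: divide_simps split: if_splits)
    then have "2 ^ n * r + 2 < 2 ^ n * t"
      by (simp add: algebra_simps)
    moreover have "0 \<le> 2 ^ n * r"
      using rt by simp
    ultimately have "Suc (?i n r) < ?i n t"
      by linarith
    then have "?b n (Suc (?i n r)) \<lless> ?b n (?i n t)"
      using refine_less[of mid s, OF mid s] by blast
    then show ?thesis
      using upper[OF rt(1), of n] lower[of t n] rt le_way_below_trans way_below_le_trans
      by (metis order_less_imp_le order_trans)
  qed
  moreover have "s n \<le> A (real n)" for n
    using lower[of "real n" 0] by simp
  moreover have "\<exists>n. A r \<le> s n" if "0 \<le> r" for r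
    using upper[OF that, of 0] by auto
  ultimately show thesis
    using that by blast
qed

lemma cu_path_exists:
  fixes s p :: "'a::positively_ordered_monoid"
  assumes cu: "cu_semigroup TYPE('a)" and p: "compact_element p" and "s \<le> p"
  obtains a :: "real \<Rightarrow> 'a" where "\<And>t u. t < u \<Longrightarrow> a u \<lless> a t" "\<And>t. t < 0 \<Longrightarrow> a t = p"
    "a 0 = s" "\<And>t. 1 \<le> t \<Longrightarrow> a t = 0" "\<And>c. c \<lless> s \<Longrightarrow> \<exists>t>0. c \<lless> a t"
proof -
  obtain z where z: "\<And>n. z n \<lless> z (Suc n)" "is_sup z s" "incseq z" "\<And>n. z n \<lless> s"
    using cu_chainE[OF cu, of s] by blast
  obtain A where A: "\<And>r t. 0 \<le> r \<Longrightarrow> r < t \<Longrightarrow> A r \<lless> A t" "\<And>n. z n \<le> A (real n)"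
      "\<And>r. 0 \<le> r \<Longrightarrow> \<exists>n. A r \<le> z n"
    using cu_dense_chain[OF cu, of z] z(1) by blast
  \<comment> \<open>The substitution \<open>r = 1 / t - 1\<close> reverses (0,1) onto the positive
    half-line, so \<open>a t\<close> climbs towards \<open>s\<close> as \<open>t\<close> decreases
    to 0.\<close>
  define a where "a t = (if t < 0 then p else if t = 0 then s else if t < 1 then A (1 / t - 1) else 0)"
    for t :: real
  have pp: "p \<lless> p"
    using p by (simp add: compact_element_def)
  then have sp: "s \<lless> p"
    using \<open>s \<le> p\<close> le_way_below_trans by blast
  have As: "A r \<lless> s" if "0 \<le> r" for r
    using A(3)[OF that] z(4) le_way_below_trans by blast
  have "a u \<lless> a t" if "t < u" for t u
  proof -
    consider "u \<ge> 1" | "u < 0" | "u = 0" | "0 < u" "u < 1" by linarith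
    then show ?thesis
    proof cases
      case 4
      then have u: "0 < 1 / u - 1" "a u = A (1 / u - 1)"
        by (auto simp: a_def)
      consider "t < 0" | "t = 0" | "0 < t" by linarith
      then show ?thesis
      proof cases
        case 3
        then have "1 / u - 1 < 1 / t - 1"
          using that 4 by (simp add: frac_less2)
        then show ?thesis
          using A(1) u 3 that 4 by (simp add: a_def)
      next
        case 1
        then show ?thesis
          using As[of "1 / u - 1"] sp u way_below_trans by (simp add: a_def) blast
      qed (use As u in \<open>simp add: a_def\<close>)
    qed (use that sp pp in \<open>auto simp: a_def zero_way_below\<close>)
  qed
  moreover have "\<exists>t>0. c \<lless> a t" if c: "c \<lless> s" for c
  proof -
    obtain n where "c \<lless> z n"
      using cu_way_below_supD[OF cu c z(3,2)] by blast
    then have "c \<lless> A (real (Suc n))"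
      using A(2)[of "Suc n"] z(1) way_below_le_trans way_below_trans by blast
    moreover have "a (1 / real (Suc (Suc n))) = A (real (Suc n))"
      by (simp add: a_def)
    ultimately show ?thesis
      by (intro exI[of _ "1 / real (Suc (Suc n))"]) auto
  qed
  ultimately show thesis
    using that[of a] by (auto simp: a_def)
qed

section \<open>Extending a path to a Cu-morphism\<close>

text \<open>The path \<open>a\<close> prescribes the image of the indicator of \<open>(t, 1]\<close>, which is \<open>1\<close> for \<open>t < 0\<close>
  and \<open>0\<close> for \<open>t \<ge> 1\<close>.\<close>
locale cu_path =
  fixes a :: "real \<Rightarrow> 'a::positively_ordered_monoid" and p :: 'a
  assumes cu: "cu_semigroup TYPE('a)"
    and O5: "cu_O5 TYPE('a)"
    and wc: "weak_cancellation TYPE('a)"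
    and decr: "t < u \<Longrightarrow> a u \<lless> a t"
    and neg: "t < 0 \<Longrightarrow> a t = p"
    and large: "1 \<le> t \<Longrightarrow> a t = 0"
begin

text \<open>The path takes the value \<open>p\<close> at two distinct negative parameters, and it
  decreases with respect to \<open>\<lless>\<close>.\<close>

lemma p_compact: "p \<lless> p"
  using decr[of "-2" "-1"] neg by simp

lemma cancel: "x + z \<lless> y + z \<Longrightarrow> x \<lless> (y::'a)"
  using wc unfolding weak_cancellation_def by blast

section \<open>Masses of increasing step functions\<close>

definition mass :: "real multiset \<Rightarrow> 'a" where
  "mass g = (\<Sum>t\<in>#g. a t)"

lemma mass_simps [simp]:
  "mass {#} = 0" "mass (add_mset t g) = a t + mass g" "mass (g + h) = mass g + mass h"
  by (simp_all add: mass_def)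

lemma mass_large: "\<forall>t\<in>#g. 1 \<le> t \<Longrightarrow> mass g = 0"
  by (induction g) (auto simp: large)

text \<open>Greedy matching: the smallest jump \<open>t\<close> of \<open>g\<close> is paired with a
  jump \<open>u\<close> of \<open>h\<close> to its left, or with both negative, so
  \<open>a t \<lless> a u\<close>. Removing the pair preserves the counting condition, and (O3) adds
  up the comparisons.\<close>

lemma mass_way_below_count:
  assumes "\<forall>z\<in>{0..<1}. size {#t \<in># g. t \<le> z#} \<le> size {#u \<in># h. u < z#}"
  shows "mass g \<lless> mass h"
  using assms
proof (induction "size g" arbitrary: g h)
  case 0
  then show ?case by (simp add: zero_way_below)
next
  case (Suc n)
  define t where "t = Min_mset g"
  have g: "g \<noteq> {#}" using Suc.hyps(2) by auto
  then have "t \<in># g" by (simp add: t_def)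
  then obtain g' where g': "g = add_mset t g'"
    using multi_member_split by metis
  have t_min: "t \<le> t'" if "t' \<in># g" for t'
    using that by (simp add: t_def)
  show ?case
  proof (cases "t < 1")
    case False
    then have "mass g = 0"
      using t_min by (intro mass_large) force
    then show ?thesis by (simp add: zero_way_below)
  next
    case True
    \<comment> \<open>The counting condition is available only on [0,1), hence the test point
      \<open>max t 0\<close>; a negative \<open>t\<close> is matched with a negative
      \<open>u\<close>.\<close>
    then have "size {#t' \<in># g. t' \<le> max t 0#} \<le> size {#u \<in># h. u < max t 0#}"
      using Suc.prems by (simp add: max_def)
    then have "size {#u \<in># h. u < max t 0#} \<noteq> 0"
      using g' by (simp del: size_eq_0_iff_empty)
    then have "{#u \<in># h. u < max t 0#} \<noteq> {#}"
      by simp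
    then obtain u where u: "u \<in># h" "u < max t 0"
      by (auto elim: multiset_nonemptyE)
    then obtain h' where h': "h = add_mset u h'"
      using multi_member_split by metis
    have "a t \<lless> a u"
      using u(2) decr[of u t] neg p_compact by (cases "t < 0") (auto simp: max_def)
    moreover have "mass g' \<lless> mass h'"
    proof (rule Suc.hyps(1))
      show "n = size g'" using Suc.hyps(2) g' by simp
      show "\<forall>z\<in>{0..<1}. size {#t \<in># g'. t \<le> z#} \<le> size {#u \<in># h'. u < z#}"
      proof
        fix z :: real assume z: "z \<in> {0..<1}"
        show "size {#t \<in># g'. t \<le> z#} \<le> size {#u \<in># h'. u < z#}"
        proof (cases "z < t")
          case True
          then have "{#t \<in># g'. t \<le> z#} = {#}"
            using t_min g' by force
          then show ?thesis by (simp only: size_empty le0)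
        next
          case False
          then have "t \<le> z" "u < z" using u(2) z by (auto simp: max_def split: if_splits)
          then show ?thesis
            using Suc.prems[rule_format, OF z] by (simp add: g' h')
        qed
      qed
    qed
    ultimately show ?thesis
      using cu_add[OF cu] g' h' by simp
  qed
qed

lemma mass_way_below: "step g \<lless> step h \<Longrightarrow> mass g \<lless> mass h"
  using step_way_below_count by (intro mass_way_below_count ballI)

lemma mass_jumps:
  assumes "\<And>j. \<tau>' j < \<tau> j"
  shows "mass (jumps \<tau> w N) \<lless> mass (jumps \<tau>' w N)"
proof (induction N)
  case (Suc N)
  have "mass (replicate_mset n (\<tau> N)) \<lless> mass (replicate_mset n (\<tau>' N))" for n
    by (induction n) (simp_all add: zero_way_below cu_add[OF cu] decr assms)
  with Suc show ?case
    by (simp add: jumps_def cu_add[OF cu])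
qed (simp add: jumps_def zero_way_below)

text \<open>The grid values \<open>m\<close> are split into ascents, giving \<open>G\<close>, and
  descents, giving \<open>H\<close>, with one jump of each kind inside every cell. Shifting the
  ascents left and the descents right makes room for the two strict mass comparisons.\<close>

lemma step_difference_between:
  assumes "k \<lless> f"
  obtains G H G' H' where "k + step H \<lless> step G" "step G' \<lless> step H' + f"
    "mass H' \<lless> mass H" "mass G \<lless> mass G'"
proof -
  obtain N m where N: "N > 0" and m: "\<And>i y. i \<le> N \<Longrightarrow> y \<in> {0..1} \<Longrightarrow>
      dist y (real i / real N) < 2 / real N \<Longrightarrow> lsc_fun k y \<le> enat (m i) \<and> enat (m i) \<le> lsc_fun f y"
    using lsc_way_below_grid[OF assms] by blast
  define u where "u j = m (Suc j) - m j" for j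
  define d where "d j = m j - m (Suc j)" for j
  define \<tau> where "\<tau> c j = (real j + c) / real N" for c j
  \<comment> \<open>The \<open>m 0\<close> jumps at \<open>-1\<close> supply the starting value as a
    constant.\<close>
  define G where "G c = jumps (\<tau> c) u N + replicate_mset (m 0) (-1)" for c
  define H where "H c = jumps (\<tau> c) d N" for c
  have balance: "m i + sum d {..<i} = m 0 + sum u {..<i}" for i
    unfolding u_def d_def by (rule sum_jumps_balance)
  have size_G: "size {#t \<in># G c. t < y#} = size {#t \<in># jumps (\<tau> c) u N. t < y#} + m 0"
    if "y \<in> {0..1}" for c y
  proof -
    have "size {#t \<in># replicate_mset n (-1). t < y#} = n" for n
      using that by (induction n) auto
    then show ?thesis by (simp add: G_def)
  qed
  have \<tau>_less: "\<tau> c j < x" if "j < i" "real i / real N \<le> x" "c \<le> 3/4" for c i j x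
  proof -
    have "real j + c < real i" using that by linarith
    then have "\<tau> c j < real i / real N" using N by (simp add: \<tau>_def divide_strict_right_mono)
    then show ?thesis using that by simp
  qed
  have \<tau>_ge: "y \<le> \<tau> c j"
    if "i < j" "x \<le> real (Suc i) / real N" "dist y x < 1/4 / real N" "c \<ge> 1/4" for c i j x y
  proof -
    have "y \<le> real (Suc i) / real N + 1/4 / real N"
      using that(2,3) by (simp add: dist_norm)
    also have "\<dots> = (real (Suc i) + 1/4) / real N"
      by (simp add: add_divide_distrib)
    also have "\<dots> \<le> \<tau> c j"
      unfolding \<tau>_def using that(1,4) by (intro divide_right_mono) auto
    finally show ?thesis .
  qed
  \<comment> \<open>A point close to the cell lies in the windows of both endpoints, so both grid
    values apply. This absorbs the uncertainty about whether the jump in cell \<open>i\<close> has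
    been passed.\<close>
  have near: "lsc_fun k y \<le> enat (min (m i) (m (Suc i))) \<and> enat (max (m i) (m (Suc i))) \<le> lsc_fun f y"
    if "y \<in> {0..1}" "dist y x < 1/4 / real N" "i < N" "real i / real N \<le> x" "x \<le> real (Suc i) / real N"
    for x y i
  proof -
    have eq: "real (Suc i) / real N = real i / real N + 1 / real N" "2 / real N = 1 / real N + 1 / real N"
        "1/4 / real N = (1 / real N) / 4"
      by (simp_all add: add_divide_distrib)
    have arith: "\<bar>y - r\<bar> < q + q \<and> \<bar>y - (r + q)\<bar> < q + q"
      if "0 < q" "\<bar>y - x\<bar> < q / 4" "r \<le> x" "x \<le> r + q" for q r :: real
      using that by linarith
    have "0 < 1 / real N" using N by simp
    then have "dist y (real i / real N) < 2 / real N" "dist y (real (Suc i) / real N) < 2 / real N"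
      using that(2,4,5) arith[of "1 / real N" "real i / real N"]
      unfolding eq dist_norm real_norm_def by blast+
    then show ?thesis
      using m[of i y] m[of "Suc i" y] that(1,3) by (auto simp: min_def max_def)
  qed
  have quarter: "1/4 / real N > 0" using N by simp
  have "lsc_below (k + step (H (1/2))) (step (G (1/2)))"
    unfolding lsc_below_def
  proof
    fix x :: real assume x: "x \<in> {0..1}"
    obtain i where i: "i < N" "real i / real N \<le> x" "x \<le> real (Suc i) / real N"
      using unit_interval_cell[OF x N] .
    have "sum u {..<i} \<le> size {#t \<in># jumps (\<tau> (1/2)) u N. t < x#}"
      using \<tau>_less[OF _ i(2)] i(1) by (intro size_jumps_lower) auto
    then have "enat (m i + sum d {..<i}) \<le> lsc_fun (step (G (1/2))) x"
      by (simp add: lsc_fun_step[OF x] size_G[OF x] balance)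
    moreover have "lsc_fun (k + step (H (1/2))) y \<le> enat (m i + sum d {..<i})"
      if y: "y \<in> {0..1}" "dist y x < 1/4 / real N" for y
    proof -
      have "size {#t \<in># H (1/2). t < y#} \<le> sum d {..<Suc i}"
        unfolding H_def using \<tau>_ge[OF _ i(3) y(2)] by (intro size_jumps_upper) auto
      then have "lsc_fun (k + step (H (1/2))) y \<le>
          enat (min (m i) (m (Suc i))) + enat (sum d {..<Suc i})"
        using near[OF y i] unfolding lsc_fun_simps lsc_fun_step[OF y(1)]
        by (intro add_mono) auto
      \<comment> \<open>Here \<open>min (m i) (m (Suc i)) + d i = m i\<close>.\<close>
      also have "\<dots> \<le> enat (m i + sum d {..<i})"
        by (simp add: d_def)
      finally show ?thesis .
    qed
    ultimately show "\<exists>M. enat M \<le> lsc_fun (step (G (1/2))) x \<and>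
        (\<exists>e>0. \<forall>y\<in>{0..1}. dist y x < e \<longrightarrow> lsc_fun (k + step (H (1/2))) y \<le> enat M)"
      using quarter by blast
  qed
  moreover have "lsc_below (step (G (1/4))) (step (H (3/4)) + f)"
    unfolding lsc_below_def
  proof
    fix x :: real assume x: "x \<in> {0..1}"
    obtain i where i: "i < N" "real i / real N \<le> x" "x \<le> real (Suc i) / real N"
      using unit_interval_cell[OF x N] .
    have "sum d {..<i} \<le> size {#t \<in># H (3/4). t < x#}"
      unfolding H_def using \<tau>_less[OF _ i(2)] i(1) by (intro size_jumps_lower) auto
    moreover have "enat (max (m i) (m (Suc i))) \<le> lsc_fun f x"
      using near[OF x _ i] quarter by simp
    ultimately have "enat (sum d {..<i}) + enat (max (m i) (m (Suc i))) \<le> lsc_fun (step (H (3/4)) + f) x"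
      unfolding lsc_fun_simps lsc_fun_step[OF x] by (intro add_mono) auto
    \<comment> \<open>Here \<open>max (m i) (m (Suc i)) = m i + u i\<close>, after which
      \<open>balance\<close> applies.\<close>
    moreover have "sum d {..<i} + max (m i) (m (Suc i)) = m 0 + sum u {..<Suc i}"
      using balance[of i] by (simp add: u_def)
    ultimately have "enat (m 0 + sum u {..<Suc i}) \<le> lsc_fun (step (H (3/4)) + f) x"
      by simp
    moreover have "lsc_fun (step (G (1/4))) y \<le> enat (m 0 + sum u {..<Suc i})"
      if y: "y \<in> {0..1}" "dist y x < 1/4 / real N" for y
    proof -
      have "size {#t \<in># jumps (\<tau> (1/4)) u N. t < y#} \<le> sum u {..<Suc i}"
        using \<tau>_ge[OF _ i(3) y(2)] by (intro size_jumps_upper) auto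
      then show ?thesis
        by (simp add: lsc_fun_step[OF y(1)] size_G[OF y(1)])
    qed
    ultimately show "\<exists>M. enat M \<le> lsc_fun (step (H (3/4)) + f) x \<and>
        (\<exists>e>0. \<forall>y\<in>{0..1}. dist y x < e \<longrightarrow> lsc_fun (step (G (1/4))) y \<le> enat M)"
      using quarter by blast
  qed
  moreover have "\<tau> c j < \<tau> c' j" if "c < c'" for c c' j
    using that N by (simp add: \<tau>_def divide_strict_right_mono)
  then have "mass (H (3/4)) \<lless> mass (H (1/2))" "mass (jumps (\<tau> (1/2)) u N) \<lless> mass (jumps (\<tau> (1/4)) u N)"
    by (simp_all add: H_def mass_jumps)
  moreover have "mass (replicate_mset n (-1)) \<lless> mass (replicate_mset n (-1))" for n
    by (induction n) (simp_all add: zero_way_below cu_add[OF cu] neg p_compact)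
  ultimately show thesis
    using that[of "H (1/2)" "G (1/2)" "G (1/4)" "H (3/4)"] cu_add[OF cu]
    by (simp add: lsc_way_below_iff G_def)
qed

text \<open>The elements way below \<open>f\<close> as measured by differences \<open>mass g - mass h\<close> with
  \<open>step g - step h\<close> compactly contained in \<open>f\<close>.\<close>
definition lowers :: "lsc01 \<Rightarrow> 'a set" where
  "lowers f = {c. \<exists>g h. step g \<lless> step h + f \<and> c + mass h \<lless> mass g}"

lemma lowersI: "step g \<lless> step h + f \<Longrightarrow> c + mass h \<lless> mass g \<Longrightarrow> c \<in> lowers f"
  unfolding lowers_def by blast

lemma lowersE:
  assumes "c \<in> lowers f"
  obtains g h where "step g \<lless> step h + f" "c + mass h \<lless> mass g"
  using assms unfolding lowers_def by blast

lemma lowers_mono: "f \<le> f' \<Longrightarrow> lowers f \<subseteq> lowers f'"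
  by (auto elim!: lowersE intro!: lowersI intro: way_below_le_trans add_left_mono)

lemma lowers_downward: "c \<in> lowers f \<Longrightarrow> c' \<le> c \<Longrightarrow> c' \<in> lowers f"
  by (auto elim!: lowersE intro!: lowersI intro: le_way_below_trans add_right_mono)

lemma lowers_add:
  assumes "c \<in> lowers f" and "c' \<in> lowers f'"
  shows "c + c' \<in> lowers (f + f')"
proof -
  obtain g h where gh: "step g \<lless> step h + f" "c + mass h \<lless> mass g"
    using assms(1) by (rule lowersE)
  obtain g' h' where gh': "step g' \<lless> step h' + f'" "c' + mass h' \<lless> mass g'"
    using assms(2) by (rule lowersE)
  show ?thesis
  proof (rule lowersI)
    show "step (g + g') \<lless> step (h + h') + (f + f')"
      using cu_add[OF cu_semigroup_lsc01 gh(1) gh'(1)] by (simp add: add_ac)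
    show "c + c' + mass (h + h') \<lless> mass (g + g')"
      using cu_add[OF cu gh(2) gh'(2)] by (simp add: add_ac)
  qed
qed

lemma way_below_sup_add:
  fixes f :: lsc01
  assumes "g \<lless> h + f" and "incseq k" and "is_sup k f"
  shows "\<exists>n. g \<lless> h + k n"
proof (rule cu_way_below_supD[OF cu_semigroup_lsc01 assms(1)])
  show "incseq (\<lambda>n. h + k n)"
    using assms(2) by (simp add: incseq_def add_left_mono)
  show "is_sup (\<lambda>n. h + k n) (h + f)"
    using cu_sup_add[OF cu_semigroup_lsc01 _ assms(2) is_sup_const assms(3)]
    by (simp add: incseq_def)
qed

text \<open>Only the condition \<open>step g \<lless> step h + f\<close> involves \<open>f\<close>,
  and it already holds at a finite stage of the supremum.\<close>

lemma lowers_sup: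
  assumes "c \<in> lowers f" and "incseq k" and "is_sup k f"
  shows "\<exists>n. c \<in> lowers (k n)"
  using assms(1) way_below_sup_add[OF _ assms(2,3)] by (meson lowersE lowersI)

text \<open>The element \<open>c\<close> stands in for the difference
  \<open>mass G - mass H\<close>, which need not exist in the monoid. The shifted pair
  \<open>G'\<close>, \<open>H'\<close> witnesses that \<open>c\<close> is in
  \<open>lowers f\<close>.\<close>

lemma lowers_interpolant:
  assumes "k \<lless> f"
  obtains G H c where "k + step H \<lless> step G" "mass G \<le> mass H + c" "c \<in> lowers f"
proof -
  obtain G H G' H' where GH: "k + step H \<lless> step G" "step G' \<lless> step H' + f"
      "mass H' \<lless> mass H" "mass G \<lless> mass G'"
    using step_difference_between[OF assms] .
  have "step H \<le> k + step H"
    using add_right_mono[OF pos_ordered, of "step H" k] by simp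
  then have "step H \<lless> step G"
    using GH(1) by (rule le_way_below_trans)
  then have "mass H + 0 \<le> mass G"
    by (simp add: way_below_imp_le mass_way_below)
  then obtain c where c: "mass H' + c \<le> mass G" "mass G \<le> mass H + c"
    using O5 GH(3) zero_way_below[of 0] unfolding cu_O5_def by blast
  have "c + mass H' \<lless> mass G'"
    using c(1) GH(4) le_way_below_trans by (metis add.commute)
  then show thesis
    using that GH(1,2) c(2) lowersI by blast
qed

text \<open>One interpolant \<open>c\<close> bounds every witness for \<open>k\<close>: eliminating
  \<open>k\<close> between \<open>step g \<lless> step h + k\<close> and
  \<open>k + step H \<lless> step G\<close> leaves a comparison of step functions, whose masses
  compare, and weak cancellation removes the common terms.\<close>

lemma lowers_bound:
  assumes "k \<lless> f"
  obtains c where "c \<in> lowers f" "\<And>c'. c' \<in> lowers k \<Longrightarrow> c' \<lless> c"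
proof -
  obtain G H c where c: "k + step H \<lless> step G" "mass G \<le> mass H + c" "c \<in> lowers f"
    using lowers_interpolant[OF assms] .
  have "c' \<lless> c" if c': "c' \<in> lowers k" for c'
  proof -
    obtain g h where gh: "step g \<lless> step h + k" "c' + mass h \<lless> mass g"
      using c' by (rule lowersE)
    have "c' + (mass h + mass H) \<le> mass (g + H)"
      using add_right_mono[OF way_below_imp_le[OF gh(2)], of "mass H"] by (simp add: add.assoc)
    also have "mass (g + H) \<lless> mass (h + G)"
      using lsc_way_below_cancel_middle[OF gh(1) c(1)] by (intro mass_way_below) simp
    finally (le_way_below_trans) have "c' + (mass h + mass H) \<lless> mass h + mass G"
      by simp
    also have "mass h + mass G \<le> c + (mass h + mass H)"
      using add_left_mono[OF c(2), of "mass h"] by (simp add: add_ac)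
    finally (way_below_le_trans) show ?thesis
      by (rule cancel)
  qed
  with c(3) that show thesis by blast
qed

text \<open>Along a chain \<open>k n\<close> for \<open>f\<close>, the bounds from
  \<open>lowers_bound\<close> interleave with the sets \<open>lowers (k n)\<close> and form a
  \<open>\<lless>\<close>-increasing sequence; its supremum is the required element.\<close>

lemma lowers_principal: "\<exists>x. \<forall>c. c \<lless> x \<longleftrightarrow> c \<in> lowers f"
proof -
  obtain k where k: "\<And>n. k n \<lless> k (Suc n)" "is_sup k f" "incseq k" "\<And>n. k n \<lless> f"
    by (rule cu_chainE[OF cu_semigroup_lsc01, of f], rule that)
  have "\<exists>c. c \<in> lowers (k (Suc n)) \<and> (\<forall>c'\<in>lowers (k n). c' \<lless> c)" for n
    by (rule lowers_bound[OF k(1)[of n]]) blast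
  then obtain c where c: "\<And>n. c n \<in> lowers (k (Suc n))" "\<And>n c'. c' \<in> lowers (k n) \<Longrightarrow> c' \<lless> c n"
    by metis
  have chain: "c n \<lless> c (Suc n)" for n
    using c by blast
  then have "incseq c"
    by (intro incseq_SucI way_below_imp_le)
  then obtain x where x: "is_sup c x"
    using cu_supE[OF cu] by blast
  have "c' \<in> lowers f" if c': "c' \<lless> x" for c'
  proof -
    obtain n where "c' \<le> c n"
      using way_belowD[OF c' \<open>incseq c\<close> x] by blast
    moreover have "c n \<in> lowers f"
      using c(1) lowers_mono[OF is_sup_upper[OF k(2)]] by blast
    ultimately show ?thesis
      using lowers_downward by blast
  qed
  moreover have "c' \<lless> x" if c': "c' \<in> lowers f" for c'
  proof -
    obtain n where "c' \<in> lowers (k n)"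
      using lowers_sup[OF c' k(3,2)] by blast
    then show ?thesis
      using c(2) way_below_le_trans is_sup_upper[OF x] by blast
  qed
  ultimately show ?thesis by blast
qed

section \<open>The extension and its Cu-morphism properties\<close>

definition extension :: "lsc01 \<Rightarrow> 'a" where
  "extension f = (SOME x. \<forall>c. c \<lless> x \<longleftrightarrow> c \<in> lowers f)"

lemma way_below_extension_iff: "c \<lless> extension f \<longleftrightarrow> c \<in> lowers f"
  using someI_ex[OF lowers_principal[of f]] unfolding extension_def by blast

text \<open>By (O2) an element is determined by the set of elements way below it, so the choice in
  \<open>extension\<close> is unique.\<close>

lemma extension_eqI:
  assumes "\<And>c. c \<in> lowers f \<longleftrightarrow> c \<lless> x"
  shows "extension f = x"
  using assms cu_leI[OF cu] way_below_imp_le way_below_extension_iff by (metis antisym)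

lemma extension_mono: "f \<le> f' \<Longrightarrow> extension f \<le> extension f'"
  by (rule cu_leI[OF cu], rule way_below_imp_le)
    (use lowers_mono in \<open>auto simp: way_below_extension_iff\<close>)

text \<open>The hypothesis is a right continuity of the path at \<open>t\<close>; it puts every
  \<open>c \<lless> a t\<close> into \<open>lowers\<close>. The converse inclusion follows from
  \<open>mass_way_below\<close> and cancellation.\<close>

lemma extension_step_singleton:
  assumes "\<And>c. c \<lless> a t \<Longrightarrow> \<exists>u. step {#u#} \<lless> step {#t#} \<and> c \<lless> a u"
  shows "extension (step {#t#}) = a t"
proof (rule extension_eqI)
  fix c
  show "c \<in> lowers (step {#t#}) \<longleftrightarrow> c \<lless> a t"
  proof
    assume "c \<in> lowers (step {#t#})"
    then obtain g h where gh: "step g \<lless> step h + step {#t#}" "c + mass h \<lless> mass g"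
      by (rule lowersE)
    have "mass g \<lless> mass (h + {#t#})"
      using gh(1) by (intro mass_way_below) (simp only: step_simps)
    with gh(2) have "c + mass h \<lless> mass (h + {#t#})"
      by (rule way_below_trans)
    then have "c + mass h \<lless> a t + mass h"
      by (simp add: add.commute)
    then show "c \<lless> a t" by (rule cancel)
  next
    assume "c \<lless> a t"
    then obtain u where "step {#u#} \<lless> step {#t#}" "c \<lless> a u"
      using assms by blast
    then show "c \<in> lowers (step {#t#})"
      by (intro lowersI[of "{#u#}" "{#}"]) simp_all
  qed
qed

lemma extension_zero: "extension 0 = 0"
proof (rule extension_eqI)
  fix c
  show "c \<in> lowers 0 \<longleftrightarrow> c \<lless> 0"
  proof
    assume "c \<in> lowers 0"
    then obtain g h where gh: "step g \<lless> step h + 0" "c + mass h \<lless> mass g"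
      by (rule lowersE)
    then have "c + mass h \<lless> 0 + mass h"
      using mass_way_below way_below_trans by fastforce
    then show "c \<lless> 0" by (rule cancel)
  next
    assume "c \<lless> 0"
    then show "c \<in> lowers 0"
      by (intro lowersI[of "{#}" "{#}"]) (simp_all add: zero_way_below)
  qed
qed

lemma extension_add: "extension (f + f') = extension f + extension f'"
proof (rule antisym)
  obtain c where c: "is_sup c (extension f)" "incseq c" "\<And>n. c n \<lless> extension f"
    by (rule cu_chainE[OF cu, of "extension f"], rule that)
  obtain c' where c': "is_sup c' (extension f')" "incseq c'" "\<And>n. c' n \<lless> extension f'"
    by (rule cu_chainE[OF cu, of "extension f'"], rule that)
  have "c n + c' n \<le> extension (f + f')" for n
    using lowers_add[of "c n" f "c' n" f'] c(3)[of n] c'(3)[of n]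
    by (intro way_below_imp_le) (simp add: way_below_extension_iff)
  then show "extension f + extension f' \<le> extension (f + f')"
    using is_sup_least[OF cu_sup_add[OF cu c(2) c'(2) c(1) c'(1)]] by blast
next
  show "extension (f + f') \<le> extension f + extension f'"
  proof (rule cu_leI[OF cu])
    fix c assume "c \<lless> extension (f + f')"
    then obtain g h where gh: "step g \<lless> step h + (f + f')" "c + mass h \<lless> mass g"
      unfolding way_below_extension_iff by (rule lowersE)
    obtain k where k: "is_sup k f" "incseq k" "\<And>n. k n \<lless> f"
      by (rule cu_chainE[OF cu_semigroup_lsc01, of f], rule that)
    obtain k' where k': "is_sup k' f'" "incseq k'" "\<And>n. k' n \<lless> f'"
      by (rule cu_chainE[OF cu_semigroup_lsc01, of f'], rule that)
    \<comment> \<open>The summands \<open>f\<close> and \<open>f'\<close> are replaced one after the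
      other by terms way below them, which have interpolants.\<close>
    have "\<exists>n. step g \<lless> (step h + f') + k n"
      using gh(1) by (intro way_below_sup_add[OF _ k(2,1)]) (simp add: add_ac)
    then obtain n where "step g \<lless> (step h + f') + k n" ..
    then have "\<exists>n'. step g \<lless> (step h + k n) + k' n'"
      by (intro way_below_sup_add[OF _ k'(2,1)]) (simp add: add_ac)
    then obtain n' where n': "step g \<lless> (step h + k' n') + k n"
      by (auto simp: add_ac)
    obtain G H b where b: "k n + step H \<lless> step G" "mass G \<le> mass H + b" "b \<in> lowers f"
      using lowers_interpolant[OF k(3)] .
    obtain G' H' b' where b': "k' n' + step H' \<lless> step G'" "mass G' \<le> mass H' + b'" "b' \<in> lowers f'"
      using lowers_interpolant[OF k'(3)] .
    \<comment> \<open>The first cancellation eliminates \<open>k n\<close> in favour of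
      \<open>G\<close> and \<open>H\<close>, the second eliminates \<open>k' n'\<close> in favour of
      \<open>G'\<close> and \<open>H'\<close>.\<close>
    have "step g + step H \<lless> (step h + step G) + k' n'"
      using lsc_way_below_cancel_middle[OF n' b(1)] by (simp add: add_ac)
    from lsc_way_below_cancel_middle[OF this b'(1)]
    have less: "mass (g + H + H') \<lless> mass (h + G + G')"
      by (intro mass_way_below) simp
    have "c + (mass h + mass H + mass H') \<le> mass (g + H + H')"
      using add_right_mono[OF way_below_imp_le[OF gh(2)], of "mass H + mass H'"]
      by (simp add: add.assoc)
    also note less
    also (le_way_below_trans) have "mass (h + G + G') \<le> (b + b') + (mass h + mass H + mass H')"
      using add_left_mono[OF add_mono[OF b(2) b'(2)], of "mass h"] by (simp add: add_ac)
    finally (way_below_le_trans) have "c \<lless> b + b'"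
      by (rule cancel)
    moreover have "b + b' \<le> extension f + extension f'"
      using b(3) b'(3) by (intro add_mono way_below_imp_le) (simp_all add: way_below_extension_iff)
    ultimately show "c \<le> extension f + extension f'"
      using way_below_imp_le[OF way_below_le_trans] by blast
  qed
qed

lemma extension_way_below:
  assumes "k \<lless> f"
  shows "extension k \<lless> extension f"
proof -
  obtain c where c: "c \<in> lowers f" "\<And>c'. c' \<in> lowers k \<Longrightarrow> c' \<lless> c"
    using lowers_bound[OF assms] by blast
  have "extension k \<le> c"
    by (rule cu_leI[OF cu], rule way_below_imp_le) (simp add: way_below_extension_iff c(2))
  then show ?thesis
    using c(1) le_way_below_trans way_below_extension_iff by blast
qed

lemma extension_sup:
  assumes "incseq z" and "is_sup z w"
  shows "is_sup (\<lambda>n. extension (z n)) (extension w)"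
  unfolding is_sup_iff
proof (intro conjI allI impI)
  show "extension (z n) \<le> extension w" for n
    by (rule extension_mono[OF is_sup_upper[OF assms(2)]])
  fix y assume y: "\<forall>n. extension (z n) \<le> y"
  show "extension w \<le> y"
  proof (rule cu_leI[OF cu])
    fix c assume "c \<lless> extension w"
    then obtain n where "c \<in> lowers (z n)"
      using lowers_sup[OF _ assms] way_below_extension_iff by blast
    then have "c \<lless> extension (z n)"
      by (simp add: way_below_extension_iff)
    then show "c \<le> y"
      using y way_below_imp_le order_trans by blast
  qed
qed

lemma cu_morphism_extension: "cu_morphism extension"
  unfolding cu_morphism_def
  by (simp add: cu cu_semigroup_lsc01 extension_zero extension_add extension_mono
      extension_way_below extension_sup)

end

text \<open>At \<open>x > t\<close> the right side is 1, which bounds any single step; at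
  \<open>x \<le> t\<close> the left side vanishes within distance \<open>u - x\<close>. For two
  negative jumps only the first case occurs, as both functions are the constant 1.\<close>

lemma step_singleton_way_below:
  assumes "t < u \<or> u < 0 \<and> t < 0"
  shows "step {#u#} \<lless> step {#t#}"
  unfolding lsc_way_below_iff lsc_below_def
proof
  fix x :: real assume x: "x \<in> {0..1}"
  show "\<exists>m. enat m \<le> lsc_fun (step {#t#}) x \<and>
      (\<exists>e>0. \<forall>y\<in>{0..1}. dist y x < e \<longrightarrow> lsc_fun (step {#u#}) y \<le> enat m)"
  proof (cases "t < x")
    case True
    then show ?thesis
      using x by (intro exI[of _ 1] conjI exI[of _ 1]) (auto simp: lsc_fun_step)
  next
    case False
    with assms x have "x < u" by auto
    then show ?thesis
      using x by (intro exI[of _ 0] conjI exI[of _ "u - x"])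
        (auto simp: lsc_fun_step dist_norm simp flip: zero_enat_def)
  qed
qed

theorem theorem1:
  fixes s p :: "'a::positively_ordered_monoid"
  assumes "cu_semigroup TYPE('a)"
    and "cu_O5 TYPE('a)"
    and "weak_cancellation TYPE('a)"
    and "compact_element p"
    and "s \<le> p"
  shows "\<exists>\<phi> :: lsc01 \<Rightarrow> 'a. cu_morphism \<phi> \<and> \<phi> (lsc_indicator {0<..1}) = s \<and> \<phi> 1 = p"
proof -
  obtain a :: "real \<Rightarrow> 'a" where a: "\<And>t u. t < u \<Longrightarrow> a u \<lless> a t" "\<And>t. t < 0 \<Longrightarrow> a t = p"
    "a 0 = s" "\<And>t. 1 \<le> t \<Longrightarrow> a t = 0" "\<And>c. c \<lless> s \<Longrightarrow> \<exists>t>0. c \<lless> a t"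
    using cu_path_exists[OF assms(1,4,5)] by blast
  interpret cu_path a p
    using assms a by unfold_locales auto
  have "extension (lsc_indicator {0<..1}) = s"
    using extension_step_singleton[of 0] a(3,5) step_singleton_way_below step_zero by metis
  moreover have "extension 1 = p"
  proof -
    \<comment> \<open>The constant 1 is compact, so \<open>u = -1\<close> itself serves as the
      approximating parameter for \<open>t = -1\<close>.\<close>
    have "step {#-1#} \<lless> step {#-1#}"
      by (rule step_singleton_way_below) simp
    then have "extension (step {#-1#}) = a (-1)"
      by (intro extension_step_singleton) blast
    then show ?thesis
      using a(2)[of "-1"] step_neg[of "-1"] by simp
  qed
  ultimately show ?thesis
    using cu_morphism_extension by blast
qed

end
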